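(* Let $n=2l$ with $l\in\mathbb N$, $l\ge1$. Then, as $r\to\infty$, $$\lambda_{1,d_h}(B_r)=\frac{(n-1)^2}{4}+\frac{\pi^2}{r^2}\left[1+\frac{2}{r}\,c_l\right]^2+o(r^{-3}),$$ where $c_l=1+\frac13+\dots+\frac{1}{2l-3}-\ln 2$ for $l\ge2$ and $c_1=-\ln 2$ (i.e. for $n=2$).
   Context: $\mathbb H^n$ denotes the $n$-dimensional hyperbolic space of constant sectional curvature $-1$, $B_r$ a geodesic ball of radius $r$ in it, and $\lambda_{1,d_h}(B_r)$ the first Dirichlet eigenvalue of the Laplace–Beltrami operator on $B_r$, i.e. $\inf\{\int_{B_r}|\nabla_{g_h}u|^2\,dv_{g_h}/\int_{B_r}u^2\,dv_{g_h}: u\in H^1_0(B_r)\setminus\{0\}\}$. *)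

theory Defs
  imports "HOL-Analysis.Analysis" "HOL-Library.Landau_Symbols"
begin

text \<open>Hyperbolic space H^n realised as the Poincare ball model: the open Euclidean
unit ball of real^'n with metric g_h = (2/(1-|x|^2))^2 times the Euclidean metric.\<close>

definition poincare_factor :: "real ^ 'n \<Rightarrow> real" where
  "poincare_factor x = 2 / (1 - (norm x)\<^sup>2)"

definition hyp_dist :: "real ^ 'n \<Rightarrow> real ^ 'n \<Rightarrow> real" where
  "hyp_dist x y = arcosh (1 + 2 * (norm (x - y))\<^sup>2 / ((1 - (norm x)\<^sup>2) * (1 - (norm y)\<^sup>2)))"

text \<open>Geodesic ball of radius r (centred at the origin; H^n is homogeneous).\<close>
definition geo_ball :: "real \<Rightarrow> (real ^ 'n) set" where
  "geo_ball r = {x. norm x < 1 \<and> hyp_dist 0 x < r}"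

text \<open>Admissible test functions: C^1 functions (with gradient field G) whose support
is a compact subset of the geodesic ball. These are dense in H^1_0(B_r).\<close>
definition admissible :: "real \<Rightarrow> (real ^ 'n \<Rightarrow> real) \<Rightarrow> (real ^ 'n \<Rightarrow> real ^ 'n) \<Rightarrow> bool" where
  "admissible r u G \<longleftrightarrow>
     (\<forall>x. (u has_derivative (\<lambda>h. G x \<bullet> h)) (at x)) \<and> continuous_on UNIV G \<and>
     compact (closure {x. u x \<noteq> 0}) \<and> closure {x. u x \<noteq> 0} \<subseteq> geo_ball r"

text \<open>Dirichlet energy  \<integral>|\<nabla>_g u|_g^2 dv_g  and  \<integral> u^2 dv_g  in the Poincare model:
|\<nabla>_g u|_g^2 = \<rho>^(-2) |\<nabla> u|^2 and dv_g = \<rho>^n dx with \<rho> the conformal factor.\<close>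
definition hyp_energy :: "real \<Rightarrow> (real ^ 'n::finite \<Rightarrow> real ^ 'n) \<Rightarrow> real" where
  "hyp_energy r G = integral (geo_ball r)
     (\<lambda>x. poincare_factor x ^ (CARD('n) - 2) * (norm (G x))\<^sup>2)"

definition hyp_mass :: "real \<Rightarrow> (real ^ 'n::finite \<Rightarrow> real) \<Rightarrow> real" where
  "hyp_mass r u = integral (geo_ball r) (\<lambda>x::real^'n. poincare_factor x ^ CARD('n) * (u x)\<^sup>2)"

definition lambda1_hyp :: "'n::finite itself \<Rightarrow> real \<Rightarrow> real" where
  "lambda1_hyp _ r = Inf {hyp_energy r G / hyp_mass r u | u G :: real ^ 'n \<Rightarrow> _.
       admissible r u G \<and> (\<exists>x. u x \<noteq> 0)}"

definition c_const :: "nat \<Rightarrow> real" where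
  "c_const l = (\<Sum>k=1..l-1. 1 / (2 * real k - 1)) - ln 2"

end

theory Submission
  imports Defs "HOL-Real_Asymp.Real_Asymp"
begin

text \<open>Write $s = |x|^2$, $n = 2l$, $m = l - 1$, $p = (n-1)/2$ and let $B_r$ be the set $s < S_r$. The radial
  solution at the bottom $p^2$ of the spectrum is $(1-s)^p J(s)$ with $J$ the integral over $[0, \pi/2]$ of
  $\sin^{2m}t\,(1 - s\cos^2 t)^{-p}$, and $2J(S_r) = r - 2c_l + o(1)$.
  Slightly above the bottom, at $p^2 + \lambda^2$, one does not need the exact solution: for fixed
  $\epsilon > 0$ and small $\lambda$ the function
  $(1-s)^p (\sin(\lambda(2J \pm \epsilon)) \mp k\lambda(1-s)^{1/4})$ is a supersolution (upper signs) or
  a subsolution (lower signs). A positive supersolution bounds the first eigenvalue from below by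
  Picone's identity; a subsolution $w$ that vanishes before $S_r$ bounds it from above through the test
  functions $w_+^{1+\delta}$, whose Rayleigh quotient is at most $(1+\delta)^2/(1+2\delta)$ times
  $p^2+\lambda^2$. Choosing $\lambda$ with $\lambda(2J(S_r) \pm 2\epsilon) = \pi$ pins the eigenvalue
  between $p^2 + \pi^2/(2J(S_r) \pm 2\epsilon)^2$.\<close>

section \<open>The zero-energy radial solution\<close>

text \<open>Origin of J: with v = cos^2 t it is, up to a constant factor, Euler's integral for the
  hypergeometric function F(m+1/2, 1/2; m+1; s), and (1-s)^p J is a multiple of the average of
  ((1-s)/|x-w|^2)^p over boundary points w, the spherical function of energy p^2. For m = 0, J is
  the complete elliptic integral K(sqrt s). The half-integer exponent p makes J an elliptic-type
  integral, so its constant term at s = 1 cannot be read off an elementary antiderivative. The same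
  integrand times cos t is elementary, and the remaining factor 1 - cos t removes the singularity at
  t = 0, so the difference has a computable limit. The accuracy o(r^-3) is forgiving: moving the
  denominator in pi^2 / r^2 by d costs about 2 d pi^2 / r^3, so the phase is needed only up to o(1).
  A fixed shift eps can thus be spent on absorbing errors, which is why comparison functions replace
  the exact solution at positive lam.\<close>

definition trig_int :: "nat \<Rightarrow> nat \<Rightarrow> real \<Rightarrow> real \<Rightarrow> real" where
  "trig_int a b q s =
     integral {0..pi/2} (\<lambda>t. sin t ^ a * cos t ^ b * (1 - s * (cos t)\<^sup>2) powr (-q))"

lemma one_minus_cos_pos:
  fixes s t :: real
  assumes "s < 1"
  shows "0 < 1 - s * (cos t)\<^sup>2"
proof -
  have c: "0 \<le> (cos t)\<^sup>2" "(cos t)\<^sup>2 \<le> 1" by (auto simp: abs_square_le_1)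
  show ?thesis
  proof (cases "s \<le> 0")
    case True
    then show ?thesis using c by (smt (verit) mult_nonpos_nonneg)
  next
    case False
    then have "s * (cos t)\<^sup>2 \<le> s * 1" using c by (intro mult_left_mono) auto
    then show ?thesis using assms by simp
  qed
qed

lemma one_minus_cos_nonzero: "s < 1 \<Longrightarrow> s * (cos t)\<^sup>2 \<noteq> (1::real)"
  using one_minus_cos_pos[of s t] by simp

lemma trig_int_has_integral:
  assumes "s < 1"
  shows "((\<lambda>t. sin t ^ a * cos t ^ b * (1 - s * (cos t)\<^sup>2) powr (-q))
            has_integral trig_int a b q s) {0..pi/2}"
  unfolding trig_int_def
  by (intro integrable_integral integrable_continuous_real continuous_intros)
     (use one_minus_cos_pos[OF assms] in \<open>auto simp: less_imp_neq[symmetric]\<close>)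

section \<open>Recurrences among the trigonometric integrals\<close>

lemma trig_int_exponent:
  assumes s: "s < 1"
  shows "trig_int a b q s = trig_int a b (q + 1) s - s * trig_int a (b + 2) (q + 1) s"
proof (rule has_integral_unique[OF trig_int_has_integral[OF s]])
  have eq: "sin t ^ a * cos t ^ b * (1 - s * (cos t)\<^sup>2) powr (-(q+1))
        - s * (sin t ^ a * cos t ^ (b+2) * (1 - s * (cos t)\<^sup>2) powr (-(q+1)))
      = sin t ^ a * cos t ^ b * (1 - s * (cos t)\<^sup>2) powr (-q)" for t
  proof -
    have p: "(1 - s * (cos t)\<^sup>2) powr (-q)
        = (1 - s * (cos t)\<^sup>2) powr (-(q+1)) * (1 - s * (cos t)\<^sup>2)"
      using powr_mult_base[of "1 - s * (cos t)\<^sup>2" "-(q+1)"] one_minus_cos_pos[OF s, of t]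
      by (simp add: mult.commute)
    show ?thesis unfolding p by (simp add: algebra_simps power2_eq_square)
  qed
  show "((\<lambda>t. sin t ^ a * cos t ^ b * (1 - s * (cos t)\<^sup>2) powr (-q)) has_integral
      trig_int a b (q + 1) s - s * trig_int a (b + 2) (q + 1) s) {0..pi/2}"
    using has_integral_diff[OF trig_int_has_integral[OF s, of a b "q+1"]
        has_integral_mult_right[OF trig_int_has_integral[OF s, of a "b+2" "q+1"], of s]]
    unfolding eq .
qed

lemma trig_int_pythagoras:
  assumes s: "s < 1"
  shows "trig_int (a + 2) b q s + trig_int a (b + 2) q s = trig_int a b q s"
proof (rule has_integral_unique[OF _ trig_int_has_integral[OF s]])
  have eq: "sin t ^ (a+2) * cos t ^ b * (1 - s * (cos t)\<^sup>2) powr (-q)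
        + sin t ^ a * cos t ^ (b+2) * (1 - s * (cos t)\<^sup>2) powr (-q)
      = sin t ^ a * cos t ^ b * (1 - s * (cos t)\<^sup>2) powr (-q)" for t
  proof -
    have "x ^ (a+2) * y ^ b * z + x ^ a * y ^ (b+2) * z = x ^ a * y ^ b * z * (x\<^sup>2 + y\<^sup>2)" for x y z :: real
      by (simp add: power_add power2_eq_square algebra_simps)
    then show ?thesis by simp
  qed
  show "((\<lambda>t. sin t ^ a * cos t ^ b * (1 - s * (cos t)\<^sup>2) powr (-q)) has_integral
      trig_int (a + 2) b q s + trig_int a (b + 2) q s) {0..pi/2}"
    using has_integral_add[OF trig_int_has_integral[OF s, of "a+2" b q]
        trig_int_has_integral[OF s, of a "b+2" q]]
    unfolding eq .
qed

lemma one_minus_cos_powr_deriv: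
  assumes s: "s < 1"
  shows "((\<lambda>t. (1 - s * (cos t)\<^sup>2) powr (-q)) has_real_derivative
     (- 2 * q * s * sin t * cos t * (1 - s * (cos t)\<^sup>2) powr (-(q+1)))) (at t within A)"
proof -
  have "((\<lambda>t. (1 - s * (cos t)\<^sup>2) powr (-q)) has_real_derivative
     (-q * (1 - s * (cos t)\<^sup>2) powr (-q - 1) * (0 - s * (2 * cos t * (- sin t))))) (at t within A)"
    by (rule derivative_eq_intros refl | use one_minus_cos_pos[OF s, of t] in simp)+
  then show ?thesis by (rule DERIV_cong) (simp add: mult_ac)
qed

text \<open>Integrates the derivative of $\cos t\,\sin^{a+1}t\,(1-s\cos^2t)^{-q}$, which vanishes at both ends.\<close>

lemma trig_int_by_parts_even:
  assumes s: "s < 1"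
  shows "trig_int (a + 2) 0 q s
     = real (a + 1) * trig_int a 2 q s - 2 * q * s * trig_int (a + 2) 2 (q + 1) s"
proof -
  have d: "((\<lambda>t. cos t * sin t ^ (a+1) * (1 - s * (cos t)\<^sup>2) powr (-q)) has_real_derivative
     (real (a+1) * (sin t ^ a * cos t ^ 2 * (1 - s * (cos t)\<^sup>2) powr (-q))
      - 2 * q * s * (sin t ^ (a+2) * cos t ^ 2 * (1 - s * (cos t)\<^sup>2) powr (-(q+1)))
      - sin t ^ (a+2) * cos t ^ 0 * (1 - s * (cos t)\<^sup>2) powr (-q))) (at t within {0..pi/2})" for t
    by (rule derivative_eq_intros one_minus_cos_powr_deriv[OF s] refl)+
       (simp add: algebra_simps power2_eq_square)
  have "((\<lambda>t. real (a+1) * (sin t ^ a * cos t ^ 2 * (1 - s * (cos t)\<^sup>2) powr (-q))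
      - 2 * q * s * (sin t ^ (a+2) * cos t ^ 2 * (1 - s * (cos t)\<^sup>2) powr (-(q+1)))
      - sin t ^ (a+2) * cos t ^ 0 * (1 - s * (cos t)\<^sup>2) powr (-q)) has_integral
     (cos (pi/2) * sin (pi/2) ^ (a+1) * (1 - s * (cos (pi/2))\<^sup>2) powr (-q)
       - cos 0 * sin 0 ^ (a+1) * (1 - s * (cos 0)\<^sup>2) powr (-q))) {0..pi/2}"
    by (rule fundamental_theorem_of_calculus)
       (use d in \<open>auto simp: has_real_derivative_iff_has_vector_derivative\<close>)
  then have z: "((\<lambda>t. real (a+1) * (sin t ^ a * cos t ^ 2 * (1 - s * (cos t)\<^sup>2) powr (-q))
      - 2 * q * s * (sin t ^ (a+2) * cos t ^ 2 * (1 - s * (cos t)\<^sup>2) powr (-(q+1)))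
      - sin t ^ (a+2) * cos t ^ 0 * (1 - s * (cos t)\<^sup>2) powr (-q)) has_integral 0) {0..pi/2}"
    by simp
  have "real (a + 1) * trig_int a 2 q s - 2 * q * s * trig_int (a + 2) 2 (q + 1) s
      - trig_int (a + 2) 0 q s = 0"
    by (rule has_integral_unique[OF _ z])
       (intro has_integral_diff has_integral_mult_right trig_int_has_integral s)
  then show ?thesis by simp
qed

text \<open>Integrates the derivative of sin^(a+1) t (1 - s cos^2 t)^(-q). Without a factor cos t
  the value at t = pi/2 is 1 instead of 0; this inhomogeneity later produces the fractions 1/(2k-1)
  of \<open>c_const\<close>.\<close>

lemma trig_int_by_parts_odd:
  assumes s: "s < 1"
  shows "1 = real (a + 1) * trig_int a 1 q s - 2 * q * s * trig_int (a + 2) 1 (q + 1) s"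
proof -
  have d: "((\<lambda>t. sin t ^ (a+1) * (1 - s * (cos t)\<^sup>2) powr (-q)) has_real_derivative
     (real (a+1) * (sin t ^ a * cos t ^ 1 * (1 - s * (cos t)\<^sup>2) powr (-q))
      - 2 * q * s * (sin t ^ (a+2) * cos t ^ 1 * (1 - s * (cos t)\<^sup>2) powr (-(q+1)))))
      (at t within {0..pi/2})" for t
    by (rule derivative_eq_intros one_minus_cos_powr_deriv[OF s] refl)+
       (simp add: algebra_simps power2_eq_square)
  have "((\<lambda>t. real (a+1) * (sin t ^ a * cos t ^ 1 * (1 - s * (cos t)\<^sup>2) powr (-q))
      - 2 * q * s * (sin t ^ (a+2) * cos t ^ 1 * (1 - s * (cos t)\<^sup>2) powr (-(q+1)))) has_integral
     (sin (pi/2) ^ (a+1) * (1 - s * (cos (pi/2))\<^sup>2) powr (-q)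
       - sin 0 ^ (a+1) * (1 - s * (cos 0)\<^sup>2) powr (-q))) {0..pi/2}"
    by (rule fundamental_theorem_of_calculus)
       (use d in \<open>auto simp: has_real_derivative_iff_has_vector_derivative\<close>)
  then have z: "((\<lambda>t. real (a+1) * (sin t ^ a * cos t ^ 1 * (1 - s * (cos t)\<^sup>2) powr (-q))
      - 2 * q * s * (sin t ^ (a+2) * cos t ^ 1 * (1 - s * (cos t)\<^sup>2) powr (-(q+1)))) has_integral 1) {0..pi/2}"
    by simp
  show ?thesis
    by (rule has_integral_unique[OF z])
       (intro has_integral_diff has_integral_mult_right trig_int_has_integral s)
qed

lemma trig_int_deriv:
  assumes s: "s < 1"
  shows "(trig_int a b q has_real_derivative q * trig_int a (b + 2) (q + 1) s) (at s)"
proof -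
  have "((\<lambda>s. integral (cbox 0 (pi/2)) (\<lambda>t. sin t ^ a * cos t ^ b * (1 - s * (cos t)\<^sup>2) powr (-q)))
     has_field_derivative integral (cbox 0 (pi/2))
       (\<lambda>t. q * (sin t ^ a * cos t ^ (b+2) * (1 - s * (cos t)\<^sup>2) powr (-(q+1))))) (at s within {..<1})"
  proof (rule leibniz_rule_field_derivative)
    fix x t :: real assume "x \<in> {..<1}"
    then have x: "x < 1" by simp
    have "((\<lambda>x. sin t ^ a * cos t ^ b * (1 - x * (cos t)\<^sup>2) powr (-q)) has_field_derivative
       sin t ^ a * cos t ^ b * (-q * (1 - x * (cos t)\<^sup>2) powr (-q - 1) * (- (cos t)\<^sup>2))) (at x within {..<1})"
      by (rule derivative_eq_intros refl | use one_minus_cos_pos[OF x, of t] in simp)+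
    then show "((\<lambda>x. sin t ^ a * cos t ^ b * (1 - x * (cos t)\<^sup>2) powr (-q)) has_field_derivative
       q * (sin t ^ a * cos t ^ (b+2) * (1 - x * (cos t)\<^sup>2) powr (-(q+1)))) (at x within {..<1})"
      by (simp add: mult_ac power_add power2_eq_square)
  next
    fix x :: real assume "x \<in> {..<1}"
    then show "(\<lambda>t. sin t ^ a * cos t ^ b * (1 - x * (cos t)\<^sup>2) powr (-q)) integrable_on cbox 0 (pi/2)"
      using trig_int_has_integral[of x a b q] by (auto simp: has_integral_integrable)
  next
    show "continuous_on ({..<1} \<times> cbox 0 (pi / 2))
      (\<lambda>(x, t). q * (sin t ^ a * cos t ^ (b + 2) * (1 - x * (cos t)\<^sup>2) powr - (q + 1)))"
      unfolding split_beta
      by (intro continuous_intros) (auto simp: one_minus_cos_nonzero)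
  qed (use s in auto)
  moreover have "at s within {..<1} = at s" using s by (intro at_within_open) auto
  ultimately show ?thesis
    unfolding trig_int_def[abs_def] by simp
qed

text \<open>\<open>zero_flux\<close> is $2(1-s)J'$; the pair $(J, 2(1-s)J')$ satisfies a first-order linear system, so no second
  derivatives of $J$ are needed.\<close>

definition zero_sol :: "nat \<Rightarrow> real \<Rightarrow> real" where
  "zero_sol m = trig_int (2 * m) 0 (real m + 1/2)"

definition zero_flux :: "nat \<Rightarrow> real \<Rightarrow> real" where
  "zero_flux m = trig_int (2 * m + 2) 0 (real m + 1/2)"

definition zero_flux' :: "nat \<Rightarrow> real \<Rightarrow> real" where
  "zero_flux' m = (\<lambda>s. (real m + 1/2) * trig_int (2 * m + 2) 2 (real m + 3/2) s)"

text \<open>Integration by parts and the two algebraic recurrences express M =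
  \<open>zero_flux\<close> through integrals of exponent p + 1 with cosine powers 2 and 4. The power
  4 cancels and a factor 1 - s survives, so 2(1-s)J' is again an integral of the same
  family.\<close>

lemma zero_sol_deriv:
  assumes s: "s < 1"
  shows "(zero_sol m has_real_derivative zero_flux m s / (2 * (1 - s))) (at s)"
proof -
  let ?T = "trig_int (2*m)"  let ?p = "real m + 1/2"
  have a: "zero_flux m s = 2 * ?p * ?T 2 ?p s - 2 * ?p * s * trig_int (2*m+2) 2 (?p+1) s"
    using trig_int_by_parts_even[OF s, of "2*m" ?p] by (simp add: zero_flux_def)
  have b: "?T 2 ?p s = ?T 2 (?p+1) s - s * ?T 4 (?p+1) s"
    using trig_int_exponent[OF s, of "2*m" 2 ?p] by simp
  have c: "trig_int (2*m+2) 2 (?p+1) s = ?T 2 (?p+1) s - ?T 4 (?p+1) s"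
    using trig_int_pythagoras[OF s, of "2*m" 2 "?p+1"] by simp
  have "zero_flux m s = 2 * (1 - s) * (?p * ?T 2 (?p+1) s)"
  proof -
    have "2 * p * (x - s * y) - 2 * p * s * (x - y) = 2 * (1 - s) * (p * x)" for p x y :: real
      by (simp add: algebra_simps)
    then show ?thesis unfolding a b c .
  qed
  then have "zero_flux m s / (2 * (1 - s)) = ?p * ?T 2 (?p+1) s" using s by simp
  then show ?thesis
    using trig_int_deriv[OF s, of "2*m" 0 ?p] by (simp add: zero_sol_def numeral_2_eq_2)
qed

lemma zero_flux_deriv:
  assumes s: "s < 1"
  shows "(zero_flux m has_real_derivative zero_flux' m s) (at s)"
  using trig_int_deriv[OF s, of "2*m+2" 0 "real m + 1/2"]
  by (simp add: zero_flux_def zero_flux'_def numeral_2_eq_2 add.assoc)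

lemma zero_flux'_continuous: "continuous_on {..<1} (zero_flux' m)"
proof -
  have "continuous_on {..<1} (trig_int (2*m+2) 2 (real m + 3/2))"
    by (intro DERIV_continuous_on[OF DERIV_subset[OF trig_int_deriv]]) auto
  then show ?thesis unfolding zero_flux'_def by (intro continuous_intros)
qed

text \<open>Together with \<open>zero_sol_deriv\<close> this is the radial equation at energy p^2
  for (1-s)^p J. With X = J and N = (1-s)J' = M/2 it says that s N' + (m+1) N - (p/2) X = 0, the
  case lam = 0 of the expression later used as residual.\<close>

lemma zero_flux_ode:
  assumes s: "s < 1"
  shows "s * zero_flux' m s + (real m + 1) * zero_flux m s = (real m + 1/2) * zero_sol m s"
proof -
  let ?p = "real m + 1/2"
  let ?A = "trig_int (2*m+2) 0 (?p+1) s"  let ?B = "trig_int (2*m) 2 (?p+1) s"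
  have q: "?p + 1 = real m + 3/2" by simp
  have 1: "zero_flux m s = ?A - s * trig_int (2*m+2) 2 (?p+1) s"
    using trig_int_exponent[OF s, of "2*m+2" 0 ?p] by (simp add: zero_flux_def numeral_2_eq_2)
  have 2: "zero_sol m s = trig_int (2*m) 0 (?p+1) s - s * ?B"
    using trig_int_exponent[OF s, of "2*m" 0 ?p] by (simp add: zero_sol_def numeral_2_eq_2)
  have 3: "?A + ?B = trig_int (2*m) 0 (?p+1) s"
    using trig_int_pythagoras[OF s, of "2*m" 0 "?p+1"] by (simp add: numeral_2_eq_2)
  have "zero_flux m s / (2 * (1 - s)) = ?p * ?B"
    using DERIV_unique[OF zero_sol_deriv[OF s, of m]] trig_int_deriv[OF s, of "2*m" 0 ?p]
    by (simp add: zero_sol_def numeral_2_eq_2)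
  then have 4: "zero_flux m s = 2 * (1 - s) * (?p * ?B)" using s by (simp add: field_simps)
  have e1: "s * zero_flux' m s = ?p * (?A - zero_flux m s)"
    unfolding 1 zero_flux'_def q by simp
  have e2: "?p * zero_sol m s = ?p * ?A + zero_flux m s / 2"
  proof -
    have "zero_flux m s / 2 = (1 - s) * (?p * ?B)" unfolding 4 by simp
    moreover have "p * (x + y - s * y) = p * x + (1 - s) * (p * y)" for p x y :: real
      by (simp add: algebra_simps)
    ultimately show ?thesis unfolding 2 3[symmetric] by simp
  qed
  have e3: "?p * (x - y) + (real m + 1) * y = ?p * x + y / 2" for x y
    by (simp add: field_simps)
  show ?thesis unfolding e1 e2 by (rule e3)
qed

text \<open>The lower bound combines Bernoulli's inequality for $(\sin^2 t/D)^{m+1}$ with the arithmetic-geometric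
  mean inequality $2\sqrt{1-s}\,\sin t\cos t \le D = \sin^2t + (1-s)\cos^2t$.\<close>

lemma sin_ratio_bounds:
  fixes s t :: real and m :: nat
  assumes s: "0 \<le> s" "s < 1" and t: "0 < t" "t \<le> pi/2"
  defines "D \<equiv> 1 - s * (cos t)\<^sup>2"
  defines "g \<equiv> sin t ^ (2*m+1) * D powr (-(real m + 1/2))"
  shows "g \<le> 1" and "1 - (real m + 1) * sqrt (1 - s) / sin t \<le> g"
proof -
  have sin: "sin t > 0" using t pi_gt_zero by (intro sin_gt_zero) linarith+
  have cos: "cos t \<ge> 0" using t by (intro cos_ge_zero) auto
  have D: "D > 0" unfolding D_def by (rule one_minus_cos_pos[OF s(2)])
  have Deq: "D = (sin t)\<^sup>2 + (1 - s) * (cos t)\<^sup>2"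
    unfolding D_def using sin_cos_squared_add[of t] by (simp add: algebra_simps)
  define q where "q = (sin t)\<^sup>2 / D"
  have q01: "0 < q" "q \<le> 1" using D sin s unfolding q_def by (auto simp: Deq)
  have g: "g = q powr (real m + 1/2)"
  proof -
    have "sin t ^ (2*m+1) = ((sin t)\<^sup>2) powr (real m + 1/2)"
    proof -
      have "((sin t)\<^sup>2) powr (real m + 1/2) = (sin t powr 2) powr (real m + 1/2)"
        using sin by simp
      also have "\<dots> = sin t powr (real (2*m+1))" by (simp add: powr_powr algebra_simps)
      finally show ?thesis using sin by (simp only: powr_realpow)
    qed
    then show ?thesis unfolding g_def q_def using sin D
      by (simp add: powr_divide powr_minus field_simps)
  qed
  show "g \<le> 1" unfolding g using q01 by (intro powr_le1) auto
  \<comment> \<open>The exponent m + 1/2 is rounded up to the integer m + 1 for Bernoulli; since q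
    <= 1 this only lowers the power, so the bound passes back to g.\<close>
  have "1 + real (m+1) * (q - 1) \<le> (1 + (q - 1)) ^ (m+1)"
    using q01 by (intro Bernoulli_inequality) auto
  also have "\<dots> = q powr (real (m+1))" using q01 by (simp only: powr_realpow) simp
  also have "\<dots> \<le> q powr (real m + 1/2)" using q01 by (intro powr_mono') auto
  finally have b: "1 - (real m + 1) * (1 - q) \<le> g" unfolding g by (simp add: algebra_simps)
  have "1 - q = (1 - s) * (cos t)\<^sup>2 / D" unfolding q_def using D by (simp add: field_simps Deq)
  also have "\<dots> \<le> sqrt (1 - s) / sin t"
  proof -
    define a where "a = sqrt (1 - s) * cos t"
    have a: "a\<^sup>2 = (1 - s) * (cos t)\<^sup>2" "a \<ge> 0" unfolding a_def using s cos by (auto simp: power_mult_distrib)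
    have "0 \<le> (a - sin t)\<^sup>2" by simp
    then have "2 * (a * sin t) \<le> D" unfolding Deq a(1)[symmetric] by (simp add: power2_diff)
    moreover have "0 \<le> a * sin t" using a sin by simp
    ultimately have "a * sin t \<le> D" by linarith
    then have "a * sin t * a \<le> D * a" using a by (intro mult_right_mono)
    moreover have "D * a \<le> D * sqrt (1 - s)" unfolding a_def using D s cos
      by (intro mult_left_mono mult_left_le) auto
    ultimately have "(1 - s) * (cos t)\<^sup>2 * sin t \<le> sqrt (1 - s) * D"
      unfolding a(1)[symmetric] by (simp add: power2_eq_square algebra_simps)
    then show ?thesis using D sin by (simp add: field_simps)
  qed
  finally have "(real m + 1) * (1 - q) \<le> (real m + 1) * (sqrt (1 - s) / sin t)"
    by (intro mult_left_mono) auto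
  with b show "1 - (real m + 1) * sqrt (1 - s) / sin t \<le> g" by simp
qed

text \<open>The integrand is sin t times the ratio controlled by \<open>sin_ratio_bounds\<close>,
  and sin t integrates to 1. Hence M tends to 1 at rate sqrt (1-s), which makes 2J behave like -ln
  (1-s) plus a constant.\<close>

lemma zero_flux_bounds:
  assumes s: "0 \<le> s" "s < 1"
  shows "zero_flux m s \<le> 1" and "1 - (real m + 1) * (pi/2) * sqrt (1 - s) \<le> zero_flux m s"
    and "0 \<le> zero_flux m s"
proof -
  note int = trig_int_has_integral[OF s(2), of "2*m+2" 0 "real m + 1/2", folded zero_flux_def]
  have eq: "sin t ^ (2*m+2) * cos t ^ 0 * (1 - s * (cos t)\<^sup>2) powr (-(real m + 1/2))
     = sin t * (sin t ^ (2*m+1) * (1 - s * (cos t)\<^sup>2) powr (-(real m + 1/2)))" for t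
    by simp
  have sin: "(sin has_integral 1) {0..pi/2}"
  proof -
    have "((\<lambda>t. sin t) has_integral (- cos (pi/2) - - cos 0)) {0..pi/2}"
      by (rule fundamental_theorem_of_calculus)
         (auto intro!: derivative_eq_intros simp flip: has_real_derivative_iff_has_vector_derivative)
    then show ?thesis by simp
  qed
  have pos: "sin t \<ge> 0" if "t \<in> {0..pi/2}" for t using that by (intro sin_ge_zero) auto
  show "zero_flux m s \<le> 1"
  proof (rule has_integral_le[OF int sin])
    fix t assume t: "t \<in> {0..pi/2}"
    show "sin t ^ (2*m+2) * cos t ^ 0 * (1 - s * (cos t)\<^sup>2) powr (-(real m + 1/2)) \<le> sin t"
      using sin_ratio_bounds(1)[OF s, of t m] pos[OF t] t unfolding eq
      by (cases "t = 0") (auto intro: mult_left_le)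
  qed
  show "0 \<le> zero_flux m s"
    by (rule has_integral_nonneg[OF int]) (simp add: pos)
  have "((\<lambda>t. sin t - (real m + 1) * sqrt (1 - s)) has_integral
      1 - (pi/2 - 0) *\<^sub>R ((real m + 1) * sqrt (1 - s))) {0..pi/2}"
    using has_integral_diff[OF sin has_integral_const_real[of "(real m + 1) * sqrt (1 - s)" 0 "pi/2"]]
    by simp
  then have low: "((\<lambda>t. sin t - (real m + 1) * sqrt (1 - s)) has_integral
      1 - (real m + 1) * (pi/2) * sqrt (1 - s)) {0..pi/2}" by (simp add: mult_ac)
  show "1 - (real m + 1) * (pi/2) * sqrt (1 - s) \<le> zero_flux m s"
  proof (rule has_integral_le[OF low int])
    fix t assume t: "t \<in> {0..pi/2}"
    show "sin t - (real m + 1) * sqrt (1 - s)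
        \<le> sin t ^ (2*m+2) * cos t ^ 0 * (1 - s * (cos t)\<^sup>2) powr (-(real m + 1/2))"
    proof (cases "t = 0")
      case True
      then show ?thesis using s by simp
    next
      case False
      then have t': "0 < t" "t \<le> pi/2" "t < pi" using t pi_gt_zero by auto
      have sin_pos: "sin t > 0" using t' by (intro sin_gt_zero)
      then have "sin t * (1 - (real m + 1) * sqrt (1 - s) / sin t)
          = sin t - (real m + 1) * sqrt (1 - s)" by (simp add: right_diff_distrib)
      then show ?thesis
        using mult_left_mono[OF sin_ratio_bounds(2)[OF s t'(1,2), of m], of "sin t"] sin_pos
        unfolding eq by linarith
    qed
  qed
qed

lemma zero_sol_mono:
  assumes "0 \<le> s" "s \<le> s'" "s' < 1"
  shows "zero_sol m s \<le> zero_sol m s'"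
proof (rule DERIV_nonneg_imp_nondecreasing[OF assms(2)])
  fix x assume x: "s \<le> x" "x \<le> s'"
  then show "\<exists>y. (zero_sol m has_real_derivative y) (at x) \<and> 0 \<le> y"
    using zero_sol_deriv[of x m] zero_flux_bounds(3)[of x m] assms
    by (intro exI[of _ "zero_flux m x / (2 * (1 - x))"]) auto
qed

lemma zero_sol_pos_at_0: "zero_sol m 0 > 0"
proof -
  let ?f = "\<lambda>t::real. sin t ^ (2*m)"
  have int: "(?f has_integral zero_sol m 0) (cbox 0 (pi/2))"
    using trig_int_has_integral[of 0 "2*m" 0 "real m + 1/2"] by (simp add: zero_sol_def)
  have "zero_sol m 0 \<noteq> 0"
  proof
    assume "zero_sol m 0 = 0"
    then have "(?f has_integral 0) (cbox 0 (pi/2))" using int by simp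
    moreover have "\<not> pi \<le> 0" using pi_gt_zero by linarith
    ultimately have "?f (pi/2) = 0"
      by (intro has_integral_0_cbox_imp_0[of 0 "pi/2" ?f]) (auto intro!: continuous_intros)
    then show False by simp
  qed
  moreover have "0 \<le> zero_sol m 0" by (rule has_integral_nonneg[OF int]) simp
  ultimately show ?thesis by simp
qed

lemma zero_sol_upper:
  assumes "0 \<le> s" "s < 1"
  shows "zero_sol m s \<le> zero_sol m 0 - ln (1 - s) / 2"
proof -
  have "zero_sol m s + ln (1 - s) / 2 \<le> zero_sol m 0 + ln (1 - 0) / 2"
  proof (rule DERIV_nonpos_imp_nonincreasing[OF assms(1)])
    fix x assume x: "0 \<le> x" "x \<le> s"
    then have x1: "x < 1" using assms by simp
    have "((\<lambda>x. ln (1 - x) / 2) has_real_derivative - (1 / (2 * (1 - x)))) (at x)"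
      using x1 by (auto intro!: derivative_eq_intros simp: field_simps)
    then have "((\<lambda>x. zero_sol m x + ln (1 - x) / 2) has_real_derivative
        (zero_flux m x / (2 * (1 - x)) + - (1 / (2 * (1 - x))))) (at x)"
      by (intro DERIV_add zero_sol_deriv x1)
    moreover have "zero_flux m x / (2 * (1 - x)) + - (1 / (2 * (1 - x))) \<le> 0"
      using zero_flux_bounds(1)[of x m] x x1 by (simp add: divide_right_mono)
    ultimately show "\<exists>y. ((\<lambda>x. zero_sol m x + ln (1 - x) / 2) has_real_derivative y) (at x) \<and> y \<le> 0"
      by blast
  qed
  then show ?thesis by simp
qed

section \<open>Asymptotics of the zero-energy solution\<close>

lemma trig_int_odd_Suc:
  assumes "s < 1"
  shows "s * trig_int (2 * Suc m) 1 (real (Suc m) + 1/2) s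
     = trig_int (2 * m) 1 (real m + 1/2) s - 1 / (2 * real m + 1)"
proof -
  have e: "2 * Suc m = 2 * m + 2" "real (Suc m) + 1/2 = real m + 1/2 + 1" by auto
  have "1 = (2 * real m + 1) * (trig_int (2 * m) 1 (real m + 1/2) s
        - s * trig_int (2 * m + 2) 1 (real m + 1/2 + 1) s)"
    using trig_int_by_parts_odd[OF assms, of "2*m" "real m + 1/2"] by (simp add: algebra_simps)
  then show ?thesis unfolding e by (simp add: field_simps)
qed

text \<open>Since 1 - s cos^2 t = (1-s) + s sin^2 t, the substitution y = sqrt s sin t turns the
  integral into that of 1 / sqrt (1-s+y^2); \<open>?F\<close> is the logarithmic form of the
  resulting inverse hyperbolic sine.\<close>

lemma trig_int_odd_0:
  assumes s: "0 < s" "s < 1"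
  shows "trig_int 0 1 (1/2) s = (ln (1 + sqrt s) - ln (1 - s) / 2) / sqrt s"
proof -
  let ?D = "\<lambda>t. 1 - s * (cos t)\<^sup>2"
  let ?F = "\<lambda>t. ln (sqrt s * sin t + sqrt (?D t)) / sqrt s"
  have D: "?D t > 0" for t by (rule one_minus_cos_pos[OF s(2)])
  have "(?F has_real_derivative sin t ^ 0 * cos t ^ 1 * ?D t powr (-(1/2))) (at t within {0..pi/2})"
    if t: "t \<in> {0..pi/2}" for t
  proof -
    have pos: "0 < sqrt s * sin t + sqrt (?D t)"
      using s D t by (intro add_nonneg_pos mult_nonneg_nonneg sin_ge_zero) auto
    have "((\<lambda>t. sqrt s * sin t + sqrt (?D t)) has_real_derivative
        sqrt s * cos t + (s * (sin t * cos t)) / sqrt (?D t)) (at t within {0..pi/2})"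
    proof -
      have "(?D has_real_derivative 2 * (s * (sin t * cos t))) (at t within {0..pi/2})"
        by (rule derivative_eq_intros refl)+ (simp add: mult_ac)
      then have d1: "((\<lambda>t. sqrt (?D t)) has_real_derivative
          inverse (sqrt (?D t)) / 2 * (2 * (s * (sin t * cos t)))) (at t within {0..pi/2})"
        by (rule DERIV_chain2[where f = sqrt and g = ?D, OF DERIV_real_sqrt[OF D]])
      have d2: "((\<lambda>t. sqrt s * sin t) has_real_derivative sqrt s * cos t) (at t within {0..pi/2})"
        by (rule DERIV_cmult[OF has_field_derivative_at_within[OF DERIV_sin]])
      have "inverse x / 2 * (2 * y) = y / x" for x y :: real by (simp add: field_simps)
      then show ?thesis using DERIV_add[OF d2 d1] by simp
    qed
    moreover have "sqrt s * cos t + (s * (sin t * cos t)) / sqrt (?D t)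
        = (sqrt s * sin t + sqrt (?D t)) * (sqrt s * cos t / sqrt (?D t))"
    proof -
      have e: "s * (sin t * cos t) = sqrt s * (sqrt s * (sin t * cos t))" using s by simp
      have i: "x * c + (x * (x * (y * c))) / z = (x * y + z) * (x * c / z)" if "z \<noteq> 0" for x c y z :: real
        using that by (simp add: field_simps)
      show ?thesis by (subst e, rule i) (use D[of t] in simp)
    qed
    ultimately have d: "((\<lambda>t. sqrt s * sin t + sqrt (?D t)) has_real_derivative
        (sqrt s * sin t + sqrt (?D t)) * (sqrt s * cos t / sqrt (?D t))) (at t within {0..pi/2})" by simp
    have "(?F has_real_derivative
        (1 / (sqrt s * sin t + sqrt (?D t)) * ((sqrt s * sin t + sqrt (?D t)) * (sqrt s * cos t / sqrt (?D t)))) / sqrt s)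
        (at t within {0..pi/2})"
      by (intro DERIV_cdivide DERIV_chain2[where f = ln and g = "\<lambda>t. sqrt s * sin t + sqrt (?D t)",
            OF DERIV_ln_divide[OF pos] d])
    moreover have "(1 / (sqrt s * sin t + sqrt (?D t)) * ((sqrt s * sin t + sqrt (?D t)) * (sqrt s * cos t / sqrt (?D t)))) / sqrt s
       = cos t / sqrt (?D t)" using pos s by simp
    moreover have "cos t / sqrt (?D t) = sin t ^ 0 * cos t ^ 1 * ?D t powr (-(1/2))"
      using D[of t] powr_half_sqrt[of "?D t"] by (simp add: powr_minus_divide)
    ultimately show ?thesis by simp
  qed
  then have i: "((\<lambda>t. sin t ^ 0 * cos t ^ 1 * ?D t powr (-(1/2))) has_integral ?F (pi/2) - ?F 0) {0..pi/2}"
    by (intro fundamental_theorem_of_calculus)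
       (auto simp: has_real_derivative_iff_has_vector_derivative)
  have "?F (pi/2) - ?F 0 = (ln (1 + sqrt s) - ln (1 - s) / 2) / sqrt s"
    using s by (simp add: ln_sqrt diff_divide_distrib add.commute)
  with has_integral_unique[OF trig_int_has_integral[OF s(2)] i] show ?thesis by simp
qed

text \<open>Each step of \<open>trig_int_odd_Suc\<close> subtracts 1/(2m+1), the summand with k = m
  + 1. The division by s does not disturb the limit, because ln (1-s) (1 - 1/s) tends to 0.\<close>

lemma trig_int_odd_limit:
  "((\<lambda>s. trig_int (2 * m) 1 (real m + 1/2) s + ln (1 - s) / 2)
      \<longlongrightarrow> ln 2 - (\<Sum>k=1..m. 1 / (2 * real k - 1))) (at_left 1)"
proof (induction m)
  case 0
  have "((\<lambda>s::real. ln (1 + sqrt s) / sqrt s + ln (1 - s) / 2 * (1 - 1 / sqrt s)) \<longlongrightarrow> ln 2) (at_left 1)"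
    by real_asymp
  moreover have "\<forall>\<^sub>F s in at_left 1. ln (1 + sqrt s) / sqrt s + ln (1 - s) / 2 * (1 - 1 / sqrt s)
      = trig_int (2 * 0) 1 (real 0 + 1/2) s + ln (1 - s) / 2"
    unfolding eventually_at_left_field
    by (intro exI[of _ 0]) (auto simp: trig_int_odd_0[simplified] field_simps)
  ultimately show ?case by (auto elim: Lim_transform_eventually)
next
  case (Suc m)
  let ?O = "\<lambda>m. trig_int (2 * m) 1 (real m + 1/2)"
  have l: "((\<lambda>s::real. ln (1 - s) / 2 * (1 - 1 / s)) \<longlongrightarrow> 0) (at_left 1)" by real_asymp
  have "((\<lambda>s. ((?O m s + ln (1 - s) / 2) - 1 / (2 * real m + 1)) / s + ln (1 - s) / 2 * (1 - 1 / s))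
     \<longlongrightarrow> ((ln 2 - (\<Sum>k=1..m. 1 / (2 * real k - 1))) - 1 / (2 * real m + 1)) / 1 + 0) (at_left 1)"
    by (intro tendsto_intros Suc.IH l) auto
  moreover have "\<forall>\<^sub>F s in at_left 1. ((?O m s + ln (1 - s) / 2) - 1 / (2 * real m + 1)) / s
      + ln (1 - s) / 2 * (1 - 1 / s) = ?O (Suc m) s + ln (1 - s) / 2"
    unfolding eventually_at_left_field
  proof (intro exI[of _ 0] conjI allI impI)
    fix s :: real assume s: "0 < s" "s < 1"
    have "?O (Suc m) s = (?O m s - 1 / (2 * real m + 1)) / s"
      using s trig_int_odd_Suc[OF s(2), of m] by (metis less_irrefl nonzero_mult_div_cancel_left)
    then show "((?O m s + ln (1 - s) / 2) - 1 / (2 * real m + 1)) / s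
      + ln (1 - s) / 2 * (1 - 1 / s) = ?O (Suc m) s + ln (1 - s) / 2"
      by (simp add: algebra_simps add_divide_distrib diff_divide_distrib)
  qed auto
  ultimately have "((\<lambda>s. ?O (Suc m) s + ln (1 - s) / 2)
     \<longlongrightarrow> ((ln 2 - (\<Sum>k=1..m. 1 / (2 * real k - 1))) - 1 / (2 * real m + 1)) / 1 + 0) (at_left 1)"
    by (rule Lim_transform_eventually)
  then show ?case by (simp add: algebra_simps)
qed

text \<open>The integrand equals (1 - cos t)/sin t, which is what the difference of the integrands
  with and without cos t becomes at s = 1.\<close>

lemma tan_half_has_integral: "((\<lambda>t. sin t / (1 + cos t)) has_integral ln 2) {0..pi/2}"
proof -
  have "((\<lambda>t. sin t / (1 + cos t)) has_integral (- ln (1 + cos (pi/2)) - - ln (1 + cos 0))) {0..pi/2}"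
  proof (rule fundamental_theorem_of_calculus)
    fix t assume t: "t \<in> {0..pi/2}"
    then have "0 \<le> cos t" by (intro cos_ge_zero) auto
    then show "((\<lambda>t. - ln (1 + cos t)) has_vector_derivative sin t / (1 + cos t)) (at t within {0..pi/2})"
      unfolding has_real_derivative_iff_has_vector_derivative[symmetric]
      by (auto intro!: derivative_eq_intros)
  qed simp
  then show ?thesis by simp
qed

text \<open>With g the ratio of \<open>sin_ratio_bounds\<close>, the two integrands differ by (1 -
  cos t) g / sin t = g sin t/(1 + cos t), bounded down to t = 0. The lower bound on g loses a factor
  1/sin t, and the numerator sin t pays for it, so the error is uniformly O(sqrt (1-s)).\<close>

lemma even_odd_diff:
  assumes s: "0 \<le> s" "s < 1"
  shows "\<bar>zero_sol m s - trig_int (2 * m) 1 (real m + 1/2) s - ln 2\<bar>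
     \<le> pi/2 * ((real m + 1) * sqrt (1 - s))"
proof -
  define p where "p = real m + 1/2"
  let ?D = "\<lambda>t. 1 - s * (cos t)\<^sup>2"
  let ?h = "\<lambda>t. sin t ^ (2*m) * cos t ^ 0 * ?D t powr (-p) - sin t ^ (2*m) * cos t ^ 1 * ?D t powr (-p)
      - sin t / (1 + cos t)"
  have int: "(?h has_integral (zero_sol m s - trig_int (2 * m) 1 p s - ln 2)) {0..pi/2}"
    unfolding zero_sol_def p_def
    by (intro has_integral_diff trig_int_has_integral[OF s(2)] tan_half_has_integral)
  have "norm (zero_sol m s - trig_int (2 * m) 1 p s - ln 2)
      \<le> ((real m + 1) * sqrt (1 - s)) * measure lborel (cbox 0 (pi/2))"
  proof (rule has_integral_bound)
    show "(?h has_integral (zero_sol m s - trig_int (2 * m) 1 p s - ln 2)) (cbox 0 (pi/2))"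
      using int by simp
    show "0 \<le> (real m + 1) * sqrt (1 - s)" using s by simp
    fix t assume "t \<in> cbox 0 (pi/2)"
    then have t: "0 \<le> t" "t \<le> pi/2" by auto
    have cos: "0 \<le> cos t" using t by (intro cos_ge_zero) auto
    show "norm (?h t) \<le> (real m + 1) * sqrt (1 - s)"
    proof (cases "t = 0")
      case True
      then show ?thesis using s by simp
    next
      case False
      have sin: "sin t > 0" using False t pi_gt_zero by (intro sin_gt_zero) linarith+
      define g where "g = sin t ^ (2*m+1) * ?D t powr (-p)"
      have g: "g \<le> 1" "1 - (real m + 1) * sqrt (1 - s) / sin t \<le> g"
        using sin_ratio_bounds[OF s, of t m] False t unfolding g_def p_def by auto
      have half: "(1 - cos t) / sin t = sin t / (1 + cos t)"
      proof -
        have "(1 - cos t) * (1 + cos t) = sin t * sin t"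
          using sin_cos_squared_add[of t] by (simp add: algebra_simps power2_eq_square)
        then show ?thesis using sin cos by (simp add: divide_simps)
      qed
      have "?h t = (1 - cos t) * (sin t ^ (2*m) * ?D t powr (-p)) - sin t / (1 + cos t)"
        by (simp add: algebra_simps)
      also have "sin t ^ (2*m) * ?D t powr (-p) = g / sin t" unfolding g_def using sin by simp
      also have "(1 - cos t) * (g / sin t) = sin t / (1 + cos t) * g"
        unfolding half[symmetric] by simp
      finally have h: "?h t = - (sin t / (1 + cos t) * (1 - g))" by (simp only: right_diff_distrib)
      have "norm (?h t) = sin t / (1 + cos t) * (1 - g)"
        unfolding h using sin cos g by simp
      also have "\<dots> \<le> sin t / (1 + cos t) * ((real m + 1) * sqrt (1 - s) / sin t)"
        using sin cos g by (intro mult_left_mono) auto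
      also have "\<dots> = (real m + 1) * sqrt (1 - s) / (1 + cos t)" using sin by simp
      also have "\<dots> \<le> (real m + 1) * sqrt (1 - s)"
        using s cos by (simp add: divide_le_eq mult_left_le)
      finally show ?thesis .
    qed
  qed
  then show ?thesis unfolding p_def by (simp add: mult_ac)
qed

text \<open>One ln 2 comes from the elementary integral and another from
  \<open>even_odd_diff\<close>; the total 2 ln 2 minus the sum is ln 2 -
  \<open>c_const\<close>.\<close>

lemma zero_sol_limit:
  "((\<lambda>s. zero_sol m s + ln (1 - s) / 2) \<longlongrightarrow> ln 2 - c_const (Suc m)) (at_left 1)"
proof -
  let ?O = "trig_int (2 * m) 1 (real m + 1/2)"
  have z: "((\<lambda>s. zero_sol m s - ?O s - ln 2) \<longlongrightarrow> 0) (at_left 1)"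
  proof (rule Lim_null_comparison)
    show "\<forall>\<^sub>F s in at_left 1. norm (zero_sol m s - ?O s - ln 2) \<le> pi/2 * ((real m + 1) * sqrt (1 - s))"
      unfolding eventually_at_left_field
      by (intro exI[of _ 0]) (use even_odd_diff in auto)
    show "((\<lambda>s. pi/2 * ((real m + 1) * sqrt (1 - s))) \<longlongrightarrow> 0) (at_left 1)"
      by (rule tendsto_eq_intros refl | simp)+
  qed
  from tendsto_add[OF tendsto_add[OF z trig_int_odd_limit[of m]] tendsto_const[of "ln 2"]]
  show ?thesis by (simp add: c_const_def algebra_simps)
qed

section \<open>Sub- and supersolutions slightly above the bottom of the spectrum\<close>

text \<open>With x proportional to lam, the linear terms of x cos x and sin x cancel, so this part
  of the residual is cubic in lam and can be dominated by terms linear in lam.\<close>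

lemma x_cos_minus_sin_bound:
  fixes x :: real
  assumes "0 \<le> x"
  shows "\<bar>x * cos x - sin x\<bar> \<le> x ^ 3"
proof -
  have b: "\<bar>t * sin t\<bar> \<le> 3 * t\<^sup>2" if "0 \<le> t" for t :: real
  proof -
    have "\<bar>t * sin t\<bar> \<le> t * t" using that abs_sin_x_le_abs_x[of t] by (simp add: abs_mult mult_left_mono)
    also have "\<dots> \<le> 3 * t\<^sup>2" by (simp add: power2_eq_square)
    finally show ?thesis .
  qed
  have "0 ^ 3 - (0 * cos 0 - sin 0) \<le> x ^ 3 - (x * cos x - sin x)"
  proof (rule DERIV_nonneg_imp_nondecreasing[OF assms])
    fix t :: real assume "0 \<le> t"
    then have "0 \<le> 3 * t\<^sup>2 + t * sin t" using b[of t] by linarith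
    moreover have "((\<lambda>x. x ^ 3 - (x * cos x - sin x)) has_real_derivative 3 * t\<^sup>2 + t * sin t) (at t)"
      by (rule derivative_eq_intros refl)+ simp
    ultimately show "\<exists>y. ((\<lambda>x. x ^ 3 - (x * cos x - sin x)) has_real_derivative y) (at t) \<and> 0 \<le> y"
      by blast
  qed
  moreover have "0 ^ 3 + (0 * cos 0 - sin 0) \<le> x ^ 3 + (x * cos x - sin x)"
  proof (rule DERIV_nonneg_imp_nondecreasing[OF assms])
    fix t :: real assume "0 \<le> t"
    then have "0 \<le> 3 * t\<^sup>2 - t * sin t" using b[of t] by linarith
    moreover have "((\<lambda>x. x ^ 3 + (x * cos x - sin x)) has_real_derivative 3 * t\<^sup>2 - t * sin t) (at t)"
      by (rule derivative_eq_intros refl)+ simp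
    ultimately show "\<exists>y. ((\<lambda>x. x ^ 3 + (x * cos x - sin x)) has_real_derivative y) (at t) \<and> 0 \<le> y"
      by blast
  qed
  ultimately show ?thesis by (simp add: abs_le_iff)
qed

text \<open>The sine joins two regimes: for lam tending to 0 it is close to 2 lam (J + d/2), and
  near s = 1, where M tends to 1, it oscillates in -ln (1-s) with frequency lam, as the leading
  singular terms of the equation require. The parameter d is the phase shift. The exponent 1/4 gives
  the correction a residual of order lam (1-s)^(-3/4), the same power of 1-s at which the errors of
  the sine will be bounded.\<close>

definition trial :: "nat \<Rightarrow> real \<Rightarrow> real \<Rightarrow> real \<Rightarrow> real \<Rightarrow> real" where
  "trial m d k lam s = sin (lam * (2 * zero_sol m s + d)) - k * lam * (1 - s) powr (1/4)"

text \<open>$(1-s)$ times the derivative of \<open>trial\<close>.\<close>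

definition trial_flux :: "nat \<Rightarrow> real \<Rightarrow> real \<Rightarrow> real \<Rightarrow> real \<Rightarrow> real" where
  "trial_flux m d k lam s = lam * zero_flux m s * cos (lam * (2 * zero_sol m s + d))
     + k * lam / 4 * (1 - s) powr (1/4)"

definition trial_flux' :: "nat \<Rightarrow> real \<Rightarrow> real \<Rightarrow> real \<Rightarrow> real \<Rightarrow> real" where
  "trial_flux' m d k lam s = lam * zero_flux' m s * cos (lam * (2 * zero_sol m s + d))
     - lam\<^sup>2 * (zero_flux m s)\<^sup>2 / (1 - s) * sin (lam * (2 * zero_sol m s + d))
     - k * lam / 16 * ((1 - s) powr (1/4) / (1 - s))"

text \<open>$(1-s)^{-p-1}(\Delta_h + p^2 + \lambda^2)$ applied to $(1-s)^p$ times \<open>trial\<close>, as a function of $s = |x|^2$.\<close>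

definition trial_residual :: "nat \<Rightarrow> real \<Rightarrow> real \<Rightarrow> real \<Rightarrow> real \<Rightarrow> real" where
  "trial_residual m d k lam s = s * trial_flux' m d k lam s + (real m + 1) * trial_flux m d k lam s
     - (real m + 1/2) / 2 * trial m d k lam s + lam\<^sup>2 / (1 - s) * trial m d k lam s"

lemma quarter_powr_deriv:
  assumes "s < 1"
  shows "((\<lambda>s. (1 - s) powr (1/4)) has_real_derivative - (1/4) * ((1 - s) powr (1/4) / (1 - s))) (at (s::real))"
proof -
  have "((\<lambda>s. (1 - s) powr (1/4)) has_real_derivative - (1/4) * (1 - s) powr (1/4 - 1)) (at s)"
    by (rule derivative_eq_intros refl | use assms in simp)+
  then show ?thesis using assms by (simp only: powr_diff) simp
qed

lemma phase_deriv:
  assumes "s < 1"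
  shows "((\<lambda>s. lam * (2 * zero_sol m s + d)) has_real_derivative lam * zero_flux m s / (1 - s)) (at s)"
  by (rule derivative_eq_intros zero_sol_deriv refl assms)+ (use assms in \<open>simp add: field_simps\<close>)

lemma trial_deriv:
  assumes s: "s < 1"
  shows "(trial m d k lam has_real_derivative trial_flux m d k lam s / (1 - s)) (at s)"
proof -
  have "((\<lambda>s. sin (lam * (2 * zero_sol m s + d)) - k * lam * (1 - s) powr (1/4)) has_real_derivative
     cos (lam * (2 * zero_sol m s + d)) * (lam * zero_flux m s / (1 - s))
       - k * lam * (- (1/4) * ((1 - s) powr (1/4) / (1 - s)))) (at s)"
    by (intro DERIV_diff DERIV_cmult DERIV_chain2[where f = sin, OF DERIV_sin] quarter_powr_deriv phase_deriv s)
  then show ?thesis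
    unfolding trial_def[abs_def] by (rule DERIV_cong)
      (simp add: trial_flux_def add_divide_distrib mult_ac)
qed

lemma trial_flux_deriv:
  assumes s: "s < 1"
  shows "(trial_flux m d k lam has_real_derivative trial_flux' m d k lam s) (at s)"
proof -
  have "((\<lambda>s. (lam * zero_flux m s) * cos (lam * (2 * zero_sol m s + d)) + k * lam / 4 * (1 - s) powr (1/4))
      has_real_derivative
     ((lam * zero_flux' m s) * cos (lam * (2 * zero_sol m s + d))
      + (- sin (lam * (2 * zero_sol m s + d)) * (lam * zero_flux m s / (1 - s))) * (lam * zero_flux m s))
      + k * lam / 4 * (- (1/4) * ((1 - s) powr (1/4) / (1 - s)))) (at s)"
    by (intro DERIV_add DERIV_mult DERIV_cmult DERIV_chain2[where f = cos, OF DERIV_cos]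
        quarter_powr_deriv phase_deriv zero_flux_deriv s)
  then show ?thesis
    unfolding trial_flux_def[abs_def] by (rule DERIV_cong)
      (simp add: trial_flux'_def power2_eq_square)
qed

lemma trial_flux'_continuous: "continuous_on {..<1} (trial_flux' m d k lam)"
proof -
  have "continuous_on {..<1} (zero_flux m)" "continuous_on {..<1} (zero_sol m)"
    by (intro DERIV_continuous_on[OF DERIV_subset[OF zero_flux_deriv]]
        DERIV_continuous_on[OF DERIV_subset[OF zero_sol_deriv]]; simp)+
  then show ?thesis
    unfolding trial_flux'_def by (intro continuous_intros zero_flux'_continuous) auto
qed

text \<open>\<open>zero_flux_ode\<close> eliminates M' in favour of J, and 2 lam J = x - lam d then
  splits the result into the cubic defect x cos x - sin x and the shift term.\<close>

lemma trial_residual_eq: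
  fixes m :: nat and d lam s :: real
  assumes s: "s < 1"
  defines "x \<equiv> lam * (2 * zero_sol m s + d)" and "p \<equiv> real m + 1/2" and "w \<equiv> (1 - s) powr (1/4)"
  shows "trial_residual m d k lam s =
     p / 2 * (x * cos x - sin x) - p / 2 * d * lam * cos x
     + lam\<^sup>2 * sin x * (1 - s * (zero_flux m s)\<^sup>2) / (1 - s)
     - k * lam * (s / 16 * (w / (1 - s)) - (real m + 1) / 4 * w - p / 2 * w + lam\<^sup>2 * (w / (1 - s)))"
proof -
  have "trial_residual m d k lam s =
     lam * cos x * (s * zero_flux' m s + (real m + 1) * zero_flux m s) - p / 2 * sin x
     + lam\<^sup>2 * sin x * (1 - s * (zero_flux m s)\<^sup>2) / (1 - s)
     - k * lam * (s / 16 * (w / (1 - s)) - (real m + 1) / 4 * w - p / 2 * w + lam\<^sup>2 * (w / (1 - s)))"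
    unfolding trial_residual_def trial_def trial_flux_def trial_flux'_def
      x_def[symmetric] w_def[symmetric] p_def[symmetric]
    by (simp add: algebra_simps add_divide_distrib diff_divide_distrib)
  also have "s * zero_flux' m s + (real m + 1) * zero_flux m s = p * zero_sol m s"
    unfolding p_def by (rule zero_flux_ode[OF s])
  also have "lam * cos x * (p * zero_sol m s) - p / 2 * sin x
     = p / 2 * (x * cos x - sin x) - p / 2 * d * lam * cos x"
    unfolding x_def by (simp add: algebra_simps)
  finally show ?thesis .
qed

text \<open>1 - s M^2 = (1-s) + s (1 - M^2), and both summands are O(sqrt (1-s)) by the bounds on
  M.\<close>

lemma flux_defect_bounds:
  assumes s: "0 \<le> s" "s < 1"
  shows "0 \<le> 1 - s * (zero_flux m s)\<^sup>2"
    and "1 - s * (zero_flux m s)\<^sup>2 \<le> (1 + (real m + 1) * pi) * sqrt (1 - s)"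
proof -
  let ?M = "zero_flux m s"
  note b = zero_flux_bounds[OF s, of m]
  have M2: "?M\<^sup>2 \<le> 1" "0 \<le> ?M\<^sup>2" using b by (auto simp: abs_square_le_1)
  have "s * ?M\<^sup>2 \<le> 1 * 1" using s M2 by (intro mult_mono) auto
  then show "0 \<le> 1 - s * ?M\<^sup>2" by simp
  have "1 - s \<le> sqrt (1 - s)" using s by (intro real_le_rsqrt) (simp add: power2_eq_square mult_left_le)
  moreover have "s * (1 - ?M\<^sup>2) \<le> 1 * (1 - ?M\<^sup>2)" using s M2 by (intro mult_right_mono) auto
  moreover have "1 - ?M\<^sup>2 \<le> 2 * (1 - ?M)"
  proof -
    have "0 \<le> (1 - ?M)\<^sup>2" by simp
    then show ?thesis by (simp add: power2_diff)
  qed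
  moreover have "2 * (1 - ?M) \<le> (real m + 1) * pi * sqrt (1 - s)" using b by (simp add: mult_ac)
  ultimately show "1 - s * ?M\<^sup>2 \<le> (1 + (real m + 1) * pi) * sqrt (1 - s)"
    by (simp add: algebra_simps)
qed

text \<open>In \<open>trial_residual_eq\<close> the terms $\frac p2(x\cos x - \sin x)$ and $\lambda^2\sin x\,(1-sM^2)/(1-s)$ have
  no fixed sign but are $O(\lambda^3(1-s)^{-3/4})$. While $\cos x \ge 1/4$ the shift term $-\frac p2 d\lambda\cos x$ has the
  right sign; otherwise $x \ge 1$, which forces $(1-s)^{-3/4} \ge C\lambda^{-3}$, and the $k$-term takes over.\<close>

lemma trial_residual_sign:
  assumes eps: "0 < eps" "eps \<le> 1" "eps \<le> zero_sol m 0"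
  obtains k lam0 where "0 < k" "k \<le> eps / 4" "0 < lam0"
    "\<And>lam s sg. \<lbrakk>0 < lam; lam \<le> lam0; 0 \<le> s; s < 1; sg = 1 \<or> sg = -1\<rbrakk>
       \<Longrightarrow> sg * trial_residual m (sg * eps) (sg * k) lam s \<le> 0"
proof -
  define p where "p = real m + 1/2"
  define J0 where "J0 = zero_sol m 0"
  have p: "p > 0" unfolding p_def by simp
  have J0: "J0 > 0" unfolding J0_def by (rule zero_sol_pos_at_0)
  \<comment> \<open>Budget of the constants: \<open>C\<close>/w will bound the phase factor
    \<open>h\<close>, \<open>B\<close> collects the two error terms, \<open>C1\<close> bounds the
    part of the k-term with the wrong sign. The choice of \<open>k\<close> keeps k C1 within p eps /
    8, the gain of the shift term at cos x = 1/4. The choice of \<open>lam0\<close> keeps the errors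
    within half of the main term k / (16 w^3) and leaves the other half for the case of small
    cosine.\<close>
  define C where "C = 2 * J0 + 5"
  define C2 where "C2 = 1 + (real m + 1) * pi"
  define B where "B = p / 2 * C ^ 3 + C * C2"
  define C1 where "C1 = 1/16 + (real m + 1) / 4 + p / 2"
  define k where "k = min (eps / 4) (p * eps / (8 * C1))"
  define lam0 where "lam0 = min 1 (k / (32 * (B + C ^ 3 * p * eps)))"
  have C: "C > 0" "C2 > 0" unfolding C_def C2_def using J0 pi_gt_zero
    by (auto intro!: add_pos_nonneg)
  have B: "B > 0" unfolding B_def using C p by (intro add_pos_pos mult_pos_pos) auto
  have C1: "C1 > 0" unfolding C1_def using p by (intro add_pos_pos) auto
  have k: "k > 0" "k \<le> eps / 4" "k * C1 \<le> p * eps / 8"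
  proof -
    show "k > 0" "k \<le> eps / 4" unfolding k_def using eps p C1 by auto
    have "k \<le> p * eps / (8 * C1)" unfolding k_def by simp
    then show "k * C1 \<le> p * eps / 8" using C1 by (simp add: field_simps)
  qed
  have den: "0 < B + C ^ 3 * p * eps" using B C p eps by (intro add_pos_pos mult_pos_pos) auto
  have lam0: "lam0 > 0" unfolding lam0_def using k den by simp
  have main: "sg * trial_residual m (sg * eps) (sg * k) lam s \<le> 0"
    if lam: "0 < lam" "lam \<le> lam0" and s: "0 \<le> s" "s < 1" and sg: "sg = 1 \<or> sg = -1" for lam s sg
  proof -
    define h where "h = 2 * zero_sol m s + sg * eps"
    define x where "x = lam * h"
    define w where "w = (1 - s) powr (1/4)"
    define E where "E = 1 - s * (zero_flux m s)\<^sup>2"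
    have w0: "0 < w" unfolding w_def using s by simp
    have w4: "w ^ 4 = 1 - s"
      unfolding w_def using s by (simp add: powr_realpow[symmetric] powr_powr)
    have w1: "w \<le> 1" unfolding w_def using s by (intro powr_le1) auto
    have wq: "w / (1 - s) = 1 / w ^ 3" unfolding w4[symmetric] using w0 by (simp add: eval_nat_numeral)
    have sqrtw: "sqrt (1 - s) = w\<^sup>2"
      unfolding w4[symmetric] using w0 by (intro real_sqrt_unique) (auto simp flip: power_mult)
    have lam1: "lam \<le> 1" and lamk: "lam * (B + C ^ 3 * p * eps) \<le> k / 32"
    proof -
      show "lam \<le> 1" using lam unfolding lam0_def by simp
      have "lam \<le> k / (32 * (B + C ^ 3 * p * eps))" using lam unfolding lam0_def by simp
      then show "lam * (B + C ^ 3 * p * eps) \<le> k / 32" using den by (simp add: field_simps)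
    qed
    have lamB: "lam * B \<le> k / 32" and lamC: "lam * (C ^ 3 * p * eps) \<le> k / 32"
    proof -
      have "0 \<le> lam * B" "0 \<le> lam * (C ^ 3 * p * eps)" using lam B C p eps by auto
      then show "lam * B \<le> k / 32" "lam * (C ^ 3 * p * eps) \<le> k / 32"
        using lamk by (auto simp: distrib_left)
    qed
    have h0: "0 \<le> h"
      using zero_sol_mono[of 0 s m] s sg eps J0 unfolding h_def J0_def by auto
    \<comment> \<open>The logarithmic growth of J is traded for the power 1/w, through -ln w <= 1/w.
      The cubic error in \<open>h\<close> then costs exactly w^-3, the order of the k-term.\<close>
    have hC: "h \<le> C / w"
    proof -
      have "ln (1 - s) = 4 * ln w" unfolding w_def using s by (simp add: ln_powr)
      then have "2 * zero_sol m s \<le> 2 * J0 - 4 * ln w"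
        using zero_sol_upper[OF s, of m] unfolding J0_def by simp
      moreover have "- ln w \<le> 1 / w"
        using ln_le_minus_one[of "1 / w"] w0 by (simp add: ln_div)
      ultimately have "h \<le> 2 * J0 + 1 + 4 / w" unfolding h_def using sg eps by auto
      also have "\<dots> \<le> (2 * J0 + 1) / w + 4 / w"
        using J0 w0 w1 by (simp add: le_divide_eq mult_left_le)
      finally show ?thesis unfolding C_def by (simp add: add_divide_distrib)
    qed
    have x0: "0 \<le> x" unfolding x_def using lam h0 by simp
    have E: "0 \<le> E" "E \<le> C2 * w\<^sup>2"
      unfolding E_def C2_def sqrtw[symmetric] by (rule flux_defect_bounds[OF s])+
    define R1 where "R1 = p / 2 * (x * cos x - sin x) + lam\<^sup>2 * sin x * E / (1 - s)"
    define Z where "Z = s / 16 * (w / (1 - s)) - (real m + 1) / 4 * w - p / 2 * w + lam\<^sup>2 * (w / (1 - s))"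
    have res: "sg * trial_residual m (sg * eps) (sg * k) lam s
        = sg * R1 - p / 2 * eps * lam * cos x - k * lam * Z"
      unfolding trial_residual_eq[OF s(2)] R1_def Z_def x_def h_def p_def E_def w_def
      using sg by (auto simp: algebra_simps)
    have R1: "\<bar>R1\<bar> \<le> lam ^ 3 * (B / w ^ 3)"
    proof -
      have h3: "h ^ 3 \<le> C ^ 3 / w ^ 3"
        using power_mono[OF hC h0, of 3] by (simp add: power_divide)
      have "\<bar>p / 2 * (x * cos x - sin x)\<bar> \<le> p / 2 * (lam ^ 3 * (C ^ 3 / w ^ 3))"
      proof -
        have "\<bar>x * cos x - sin x\<bar> \<le> lam ^ 3 * h ^ 3"
          using x_cos_minus_sin_bound[OF x0] by (simp add: x_def power_mult_distrib)
        also have "\<dots> \<le> lam ^ 3 * (C ^ 3 / w ^ 3)" using lam h3 by (intro mult_left_mono) auto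
        finally have "p / 2 * \<bar>x * cos x - sin x\<bar> \<le> p / 2 * (lam ^ 3 * (C ^ 3 / w ^ 3))"
          using p by (intro mult_left_mono) auto
        moreover have "\<bar>p / 2 * (x * cos x - sin x)\<bar> = p / 2 * \<bar>x * cos x - sin x\<bar>"
          using p by (simp add: abs_mult)
        ultimately show ?thesis by simp
      qed
      moreover have "\<bar>lam\<^sup>2 * sin x * E / (1 - s)\<bar> \<le> lam ^ 3 * (C * C2 / w ^ 3)"
      proof -
        have "\<bar>sin x\<bar> \<le> lam * (C / w)"
          using abs_sin_x_le_abs_x[of x] x0 hC lam mult_left_mono[OF hC, of lam] by (simp add: x_def)
        then have "\<bar>sin x\<bar> * E \<le> lam * (C / w) * (C2 * w\<^sup>2)"
          using E lam C w0 by (intro mult_mono) auto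
        then have "lam\<^sup>2 * (\<bar>sin x\<bar> * E) / (1 - s) \<le> lam\<^sup>2 * (lam * (C / w) * (C2 * w\<^sup>2)) / (1 - s)"
          using s by (intro divide_right_mono mult_left_mono) auto
        also have "\<dots> = lam ^ 3 * (C * C2 / w ^ 3)"
          unfolding w4[symmetric] using w0 by (simp add: field_simps eval_nat_numeral)
        finally show ?thesis using E s by (simp add: abs_mult mult.assoc)
      qed
      ultimately have "\<bar>R1\<bar> \<le> p / 2 * (lam ^ 3 * (C ^ 3 / w ^ 3)) + lam ^ 3 * (C * C2 / w ^ 3)"
        unfolding R1_def by linarith
      also have "\<dots> = lam ^ 3 * (B / w ^ 3)" unfolding B_def by (simp add: algebra_simps add_divide_distrib)
      finally show ?thesis .
    qed
    have Z: "1 / (16 * w ^ 3) - C1 \<le> Z"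
    proof -
      have "s / 16 * (1 / w ^ 3) = 1 / (16 * w ^ 3) - w / 16"
      proof -
        have "s = 1 - w ^ 4" using w4 by simp
        then show ?thesis using w0 by (simp add: field_simps eval_nat_numeral)
      qed
      moreover have "(1/16 + (real m + 1) / 4 + p / 2) * w \<le> C1"
        unfolding C1_def[symmetric] using C1 w1 by (simp add: mult_left_le)
      moreover have "0 \<le> lam\<^sup>2 * (1 / w ^ 3)" using w0 by simp
      ultimately show ?thesis unfolding Z_def wq by (simp add: algebra_simps)
    qed
    have "sg * trial_residual m (sg * eps) (sg * k) lam s
        \<le> lam ^ 3 * (B / w ^ 3) - p / 2 * eps * lam * cos x - k * lam * (1 / (16 * w ^ 3) - C1)"
    proof -
      have "sg * R1 \<le> \<bar>R1\<bar>" using sg by auto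
      moreover have "k * lam * (1 / (16 * w ^ 3) - C1) \<le> k * lam * Z"
        using Z k lam by (intro mult_left_mono) auto
      ultimately show ?thesis unfolding res using R1 by linarith
    qed
    also have "\<dots> = lam * (lam\<^sup>2 * B / w ^ 3 - p / 2 * eps * cos x - k / (16 * w ^ 3) + k * C1)"
      by (simp add: algebra_simps eval_nat_numeral)
    also have "\<dots> \<le> 0"
    proof -
      have "lam\<^sup>2 * B \<le> k / 32"
      proof -
        have "lam\<^sup>2 * B \<le> lam * B" using lam lam1 B by (simp add: power2_eq_square mult_left_le)
        then show ?thesis using lamB by linarith
      qed
      then have "lam\<^sup>2 * B / w ^ 3 \<le> k / 32 / w ^ 3" using w0 by (intro divide_right_mono) auto
      then have 1: "lam\<^sup>2 * B / w ^ 3 - k / (16 * w ^ 3) \<le> - (k / 32 * (1 / w ^ 3))" by (simp add: field_simps)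
      have 2: "p / 2 * eps * (1/4 - cos x) \<le> k / 32 * (1 / w ^ 3)"
      proof (cases "cos x \<ge> 1/4")
        case True
        then have "p / 2 * eps * (1/4 - cos x) \<le> 0" using p eps by (simp add: mult_nonneg_nonpos)
        moreover have "0 \<le> k / 32 * (1 / w ^ 3)" using k w0 by simp
        ultimately show ?thesis by linarith
      next
        case False
        have "x \<ge> 1"
        proof (rule ccontr)
          assume "\<not> x \<ge> 1"
          then have "\<bar>sin (x/2)\<bar> \<le> 1/2" using abs_sin_x_le_abs_x[of "x/2"] x0 by linarith
          then have "(sin (x/2))\<^sup>2 \<le> (1/2)\<^sup>2" by (metis abs_le_square_iff abs_of_pos half_gt_zero zero_less_one)
          then have "cos x \<ge> 1/2" using cos_double_sin[of "x/2"] by (simp add: power2_eq_square)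
          then show False using False by simp
        qed
        then have "1 \<le> lam * (C / w)" using mult_left_mono[OF hC, of lam] lam unfolding x_def by linarith
        then have "w \<le> lam * C" using w0 by (simp add: field_simps)
        then have "w ^ 3 \<le> (lam * C) ^ 3" using w0 by (intro power_mono) auto
        also have "\<dots> \<le> lam * C ^ 3"
          using lam lam1 C by (simp add: power_mult_distrib power3_eq_cube mult_le_one)
        finally have "w ^ 3 * (p * eps) \<le> lam * C ^ 3 * (p * eps)" using p eps by (intro mult_right_mono) auto
        then have "p * eps * w ^ 3 \<le> k / 32" using lamC by (simp add: mult_ac)
        then have "p * eps \<le> k / 32 * (1 / w ^ 3)" using w0 by (simp add: field_simps)
        moreover have "p / 2 * eps * (1/4 - cos x) \<le> p / 2 * eps * 2"
        proof (intro mult_left_mono)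
          show "1/4 - cos x \<le> 2" using cos_ge_minus_one[of x] by linarith
        qed (use p eps in auto)
        ultimately show ?thesis by simp
      qed
      have "p / 2 * eps * (1/4 - cos x) = p * eps / 8 - p / 2 * eps * cos x" by (simp add: algebra_simps)
      with 1 2 k(3) have "lam\<^sup>2 * B / w ^ 3 - p / 2 * eps * cos x - k / (16 * w ^ 3) + k * C1 \<le> 0"
        by linarith
      then show ?thesis using lam by (simp add: mult_nonneg_nonpos)
    qed
    finally show ?thesis .
  qed
  show ?thesis by (rule that[OF k(1,2) lam0 main])
qed

section \<open>Energy and mass in the Poincare ball\<close>

text \<open>The integral of $f(cx)$ is $c^{-n}$ times that of $f$; differentiate both sides at $c = 1$.\<close>

lemma integral_radial_divergence:
  fixes f :: "real ^ 'n::finite \<Rightarrow> real" and g :: "real ^ 'n \<Rightarrow> real ^ 'n"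
  assumes deriv: "\<And>x. (f has_derivative (\<lambda>h. g x \<bullet> h)) (at x)"
    and cont: "continuous_on UNIV g"
    and supp: "\<And>x. 1 \<le> norm x \<Longrightarrow> f x = 0"
  shows "((\<lambda>x. real CARD('n) * f x + g x \<bullet> x) has_integral 0) (cbox (- One) One)"
proof -
  let ?n = "real CARD('n)"
  \<comment> \<open>The doubled box contains the support of x -> f (c x) for every c between 1/2 and
    2, so the domain stays fixed while c varies and differentiation under the integral
    applies.\<close>
  define a where "a = - 2 *\<^sub>R (One :: real ^ 'n)"
  define b where "b = 2 *\<^sub>R (One :: real ^ 'n)"
  have box: "cbox (- One) (One :: real ^ 'n) \<subseteq> cbox a b"
    unfolding a_def b_def by (rule subset_box_imp(1)) simp
  have outside: "f x = 0" if "x \<notin> cbox (- One) One" for x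
  proof (rule supp, rule ccontr)
    assume n: "\<not> 1 \<le> norm x"
    have "- 1 \<le> x \<bullet> i \<and> x \<bullet> i \<le> 1" if "i \<in> Basis" for i
      using Basis_le_norm[OF that, of x] n by (auto simp: abs_le_iff)
    then show False using that by (auto simp: mem_box)
  qed
  have contf: "continuous_on S f" for S
    by (rule has_derivative_continuous_on[OF has_derivative_at_withinI[OF deriv]])
  define P where "P = integral (cbox a b) f"
  have fint: "(f has_integral P) (cbox a b)"
    unfolding P_def by (intro integrable_integral integrable_continuous contf)
  have scaled: "integral (cbox a b) (\<lambda>x. f (c *\<^sub>R x)) = P / c ^ CARD('n)" if c: "1/2 < c" "c < 2" for c
  proof -
    have "(f has_integral P) (cbox (- One) One)"
    proof -
      have "((\<lambda>x. if x \<in> cbox (- One) One then f x else 0) has_integral P) (cbox a b)"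
        by (rule has_integral_eq[OF _ fint]) (auto simp: outside)
      then show ?thesis by (simp only: has_integral_restrict[OF box])
    qed
    then have "((\<lambda>x. f (c *\<^sub>R x + 0)) has_integral (P /\<^sub>R c ^ DIM(real ^ 'n)))
           (cbox ((- One - 0) /\<^sub>R c) ((One - 0) /\<^sub>R c))"
      using c by (intro has_integral_affinity') auto
    then have "((\<lambda>x. f (c *\<^sub>R x)) has_integral (P / c ^ CARD('n))) (cbox (- (One /\<^sub>R c)) (One /\<^sub>R c))"
      by (simp add: divide_inverse mult.commute)
    then have "((\<lambda>x. f (c *\<^sub>R x)) has_integral (P / c ^ CARD('n))) (cbox a b)"
    proof (rule has_integral_on_superset)
      have "inverse c \<le> 2" "0 < inverse c" using c by (auto simp: field_simps)
      then show "cbox (- (One /\<^sub>R c)) (One /\<^sub>R c) \<subseteq> cbox a b"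
        unfolding a_def b_def by (intro subset_box_imp(1)) auto
    next
      fix x :: "real ^ 'n" assume x: "x \<notin> cbox (- (One /\<^sub>R c)) (One /\<^sub>R c)"
      have "c *\<^sub>R x \<notin> cbox (- One) One"
      proof
        assume "c *\<^sub>R x \<in> cbox (- One) One"
        then have "x \<in> cbox (- (One /\<^sub>R c)) (One /\<^sub>R c)"
          using c by (auto simp: mem_box field_simps)
        with x show False by simp
      qed
      then show "f (c *\<^sub>R x) = 0" by (rule outside)
    qed
    then show ?thesis by (rule integral_unique)
  qed
  have "((\<lambda>c. integral (cbox a b) (\<lambda>x. f (c *\<^sub>R x))) has_field_derivative
      integral (cbox a b) (\<lambda>x. g (1 *\<^sub>R x) \<bullet> x)) (at 1 within UNIV)"
  proof (rule leibniz_rule_field_derivative)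
    fix c :: real and x :: "real ^ 'n"
    have "((\<lambda>c. f (c *\<^sub>R x)) has_derivative (\<lambda>h. g (c *\<^sub>R x) \<bullet> (h *\<^sub>R x))) (at c)"
      by (rule has_derivative_compose[OF _ deriv]) (auto intro!: derivative_eq_intros)
    then show "((\<lambda>c. f (c *\<^sub>R x)) has_field_derivative g (c *\<^sub>R x) \<bullet> x) (at c within UNIV)"
      unfolding has_field_derivative_def by (simp add: mult_commute_abs)
  next
    fix c :: real
    show "(\<lambda>x. f (c *\<^sub>R x)) integrable_on cbox a b"
      by (intro integrable_continuous continuous_on_compose2[OF contf[of UNIV]] continuous_intros) auto
  next
    show "continuous_on (UNIV \<times> cbox a b) (\<lambda>(c, x). g (c *\<^sub>R x) \<bullet> x)"
      unfolding split_beta by (intro continuous_intros continuous_on_compose2[OF cont]) auto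
  qed auto
  then have d1: "((\<lambda>c. integral (cbox a b) (\<lambda>x. f (c *\<^sub>R x))) has_field_derivative
      integral (cbox a b) (\<lambda>x. g x \<bullet> x)) (at 1)" by simp
  have "((\<lambda>c. P / c ^ CARD('n)) has_field_derivative (- ?n * P)) (at 1)"
    by (rule derivative_eq_intros refl | simp)+
  then have d2: "((\<lambda>c. integral (cbox a b) (\<lambda>x. f (c *\<^sub>R x))) has_field_derivative (- ?n * P)) (at 1)"
    by (rule has_field_derivative_transform_within_open[where S = "{1/2<..<2}"]) (auto simp: scaled)
  have "integral (cbox a b) (\<lambda>x. g x \<bullet> x) = - ?n * P" by (rule DERIV_unique[OF d1 d2])
  moreover have "((\<lambda>x. g x \<bullet> x) has_integral integral (cbox a b) (\<lambda>x. g x \<bullet> x)) (cbox a b)"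
    by (intro integrable_integral integrable_continuous continuous_intros continuous_on_subset[OF cont]) auto
  ultimately have "((\<lambda>x. g x \<bullet> x) has_integral (- ?n * P)) (cbox a b)" by simp
  from has_integral_add[OF has_integral_mult_right[OF fint, of ?n] this]
  have big: "((\<lambda>x. ?n * f x + g x \<bullet> x) has_integral 0) (cbox a b)" by simp
  have gz: "g x = 0" if "x \<notin> cbox (- One) One" for x
  proof -
    have "(f has_derivative (\<lambda>h. 0)) (at x)"
      by (rule has_derivative_transform_within_open[where s = "- cbox (- One) One", OF has_derivative_const])
         (use that outside closed_cbox in auto)
    from has_derivative_unique[OF deriv[of x] this] have "g x \<bullet> g x = 0" by (rule fun_cong)
    then show ?thesis by simp
  qed
  have "((\<lambda>x. if x \<in> cbox (- One) One then ?n * f x + g x \<bullet> x else 0) has_integral 0) (cbox a b)"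
    by (rule has_integral_eq[OF _ big]) (auto simp: outside gz)
  then show ?thesis by (simp only: has_integral_restrict[OF box])
qed

section \<open>Geodesic balls as Euclidean balls, and extension by zero\<close>

text \<open>This is tanh^2 (r/2).\<close>

definition euclid_radius_sq :: "real \<Rightarrow> real" where
  "euclid_radius_sq r = (cosh r - 1) / (cosh r + 1)"

lemma euclid_radius_sq_bounds:
  assumes "0 < r"
  shows "0 < euclid_radius_sq r" "euclid_radius_sq r < 1"
proof -
  have "cosh r > 1" using assms cosh_real_strict_mono[of 0 r] by simp
  then show "0 < euclid_radius_sq r" "euclid_radius_sq r < 1" by (auto simp: euclid_radius_sq_def)
qed

lemma geo_ball_eq:
  assumes r: "0 < r"
  shows "geo_ball r = {x :: real ^ 'n. (norm x)\<^sup>2 < euclid_radius_sq r}"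
proof -
  have "x \<in> geo_ball r \<longleftrightarrow> (norm x)\<^sup>2 < euclid_radius_sq r" for x :: "real ^ 'n"
  proof (cases "norm x < 1")
    case False
    then have "1 \<le> (norm x)\<^sup>2" by simp
    then have "\<not> (norm x)\<^sup>2 < euclid_radius_sq r" using euclid_radius_sq_bounds[OF r] by linarith
    then show ?thesis using False by (simp add: geo_ball_def)
  next
    case True
    define s where "s = (norm x)\<^sup>2"
    have s: "0 \<le> s" "s < 1" unfolding s_def using True by (auto simp: power_less_one_iff abs_square_less_1)
    define y where "y = 1 + 2 * s / (1 - s)"
    have y: "1 \<le> y" unfolding y_def using s by simp
    have "arcosh y < r \<longleftrightarrow> cosh (arcosh y) < cosh r"
      using y r by (intro cosh_real_nonneg_less_iff[symmetric]) (auto simp: arcosh_nonneg_real)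
    also have "cosh (arcosh y) = y" using y by (rule cosh_arcosh_real)
    also have "y < cosh r \<longleftrightarrow> s < euclid_radius_sq r"
      unfolding y_def euclid_radius_sq_def using s cosh_real_ge_1[of r] by (simp add: divide_simps) (auto simp: algebra_simps)
    finally show ?thesis using True by (simp add: geo_ball_def hyp_dist_def s_def y_def)
  qed
  then show ?thesis by blast
qed

lemma open_geo_ball: "0 < r \<Longrightarrow> open (geo_ball r :: (real ^ 'n) set)"
  unfolding geo_ball_eq by (intro open_Collect_less continuous_intros)

lemma geo_ball_subset_cbox: "geo_ball r \<subseteq> cbox (- One) (One :: real ^ 'n)"
proof
  fix x :: "real ^ 'n" assume "x \<in> geo_ball r"
  then have n: "norm x < 1" by (simp add: geo_ball_def)
  have "- 1 \<le> x \<bullet> i \<and> x \<bullet> i \<le> 1" if "i \<in> Basis" for i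
    using Basis_le_norm[OF that, of x] n by (auto simp: abs_le_iff)
  then show "x \<in> cbox (- One) One" by (auto simp: mem_box)
qed

text \<open>The open sets B and the complement of K cover the space, and on the latter the extension
  is 0. It is used because the conformal weights blow up at the unit sphere: densities supported
  inside the ball are extended by zero and integrated over a box.\<close>

lemma extend_zero_continuous:
  fixes f :: "'a::topological_space \<Rightarrow> 'b::real_normed_vector"
  assumes "open B" "closed K" "K \<subseteq> B" and f: "continuous_on B f"
    and z: "\<And>x. x \<in> B \<Longrightarrow> x \<notin> K \<Longrightarrow> f x = 0"
  shows "continuous_on UNIV (\<lambda>x. if x \<in> B then f x else 0)"
proof -
  let ?h = "\<lambda>x. if x \<in> B then f x else 0"
  have "continuous_on B ?h" by (rule continuous_on_eq[OF f]) simp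
  moreover have "continuous_on (- K) ?h"
    by (rule continuous_on_eq[OF continuous_on_const[of _ 0]]) (use z in auto)
  ultimately have "continuous_on (B \<union> - K) ?h"
    using assms by (intro continuous_on_open_Un) auto
  moreover have "B \<union> - K = UNIV" using assms by auto
  ultimately show ?thesis by simp
qed

lemma extend_zero_derivative:
  fixes f :: "'a::real_normed_vector \<Rightarrow> 'b::real_normed_vector"
  assumes "open B" "closed K" "K \<subseteq> B" and f: "\<And>x. x \<in> B \<Longrightarrow> (f has_derivative f' x) (at x)"
    and z: "\<And>x. x \<in> B \<Longrightarrow> x \<notin> K \<Longrightarrow> f x = 0"
  shows "((\<lambda>x. if x \<in> B then f x else 0) has_derivative (if x \<in> B then f' x else (\<lambda>h. 0))) (at x)"
proof (cases "x \<in> B")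
  case True
  then show ?thesis
    using has_derivative_transform_within_open[OF f[OF True] assms(1) True] by simp
next
  case False
  have "((\<lambda>x. if x \<in> B then f x else 0) has_derivative (\<lambda>h. 0)) (at x)"
    by (rule has_derivative_transform_within_open[where s = "- K", OF has_derivative_const])
       (use assms False in auto)
  with False show ?thesis by simp
qed

lemma integral_geo_ball:
  fixes f :: "real ^ 'n::finite \<Rightarrow> real"
  assumes r: "0 < r" and K: "closed K" "K \<subseteq> geo_ball r" and f: "continuous_on (geo_ball r) f"
    and z: "\<And>x. x \<in> geo_ball r \<Longrightarrow> x \<notin> K \<Longrightarrow> f x = 0"
  shows "((\<lambda>x. if x \<in> geo_ball r then f x else 0) has_integral integral (geo_ball r) f) (cbox (- One) One)"
proof -
  have "(\<lambda>x. if x \<in> geo_ball r then f x else 0) integrable_on cbox (- One) One"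
    by (intro integrable_continuous continuous_on_subset[OF extend_zero_continuous[OF open_geo_ball[OF r] K f z]]) auto
  then have "f integrable_on geo_ball r"
    by (simp only: integrable_on_def has_integral_restrict[OF geo_ball_subset_cbox])
  then show ?thesis
    by (simp only: has_integral_restrict[OF geo_ball_subset_cbox] integrable_integral)
qed

lemma poincare_factor_continuous:
  "continuous_on (geo_ball r) (poincare_factor :: real ^ 'n \<Rightarrow> real)"
proof -
  have "1 - (norm x)\<^sup>2 \<noteq> 0" if "x \<in> geo_ball r" for x :: "real ^ 'n"
  proof -
    have "\<bar>norm x\<bar> < 1" using that by (simp add: geo_ball_def)
    then have "(norm x)\<^sup>2 < 1" by (simp only: abs_square_less_1)
    then show ?thesis by linarith
  qed
  then show ?thesis unfolding poincare_factor_def by (intro continuous_intros) auto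
qed

lemma admissible_support:
  assumes "admissible r u G"
  obtains K where "compact K" "K \<subseteq> geo_ball r" "\<And>x. x \<notin> K \<Longrightarrow> u x = 0" "\<And>x. x \<notin> K \<Longrightarrow> G x = 0"
proof -
  define K where "K = closure {x. u x \<noteq> 0}"
  have K: "compact K" "K \<subseteq> geo_ball r" using assms by (auto simp: admissible_def K_def)
  have z: "u x = 0" if "x \<notin> K" for x
    using that subsetD[OF closure_subset, of x "{x. u x \<noteq> 0}"] unfolding K_def by auto
  have "G x = 0" if x: "x \<notin> K" for x
  proof -
    have "(u has_derivative (\<lambda>h. 0)) (at x)"
      by (rule has_derivative_transform_within_open[where s = "- K", OF has_derivative_const])
         (use x z compact_imp_closed[OF K(1)] in auto)
    moreover have "(u has_derivative (\<lambda>h. G x \<bullet> h)) (at x)" using assms by (simp add: admissible_def)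
    ultimately have "(\<lambda>h. G x \<bullet> h) = (\<lambda>h. 0)" using has_derivative_unique by blast
    then have "G x \<bullet> G x = 0" by (rule fun_cong)
    then show ?thesis by simp
  qed
  with K z show ?thesis using that by blast
qed

lemma admissible_continuous:
  assumes "admissible r u G"
  shows "continuous_on A u" "continuous_on A G"
proof -
  show "continuous_on A u"
    by (rule has_derivative_continuous_on[where f' = "\<lambda>x h. G x \<bullet> h", OF has_derivative_at_withinI])
       (use assms in \<open>simp add: admissible_def\<close>)
  show "continuous_on A G" using assms by (auto simp: admissible_def intro: continuous_on_subset)
qed

lemma hyp_energy_has_integral:
  fixes u :: "real ^ 'n::finite \<Rightarrow> real"
  assumes r: "0 < r" and adm: "admissible r u G"
  shows "((\<lambda>x. if x \<in> geo_ball r then poincare_factor x ^ (CARD('n) - 2) * (norm (G x))\<^sup>2 else 0)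
      has_integral hyp_energy r G) (cbox (- One) One)"
proof -
  obtain K where K: "compact K" "K \<subseteq> geo_ball r"
    "\<And>x. x \<notin> K \<Longrightarrow> u x = 0" "\<And>x. x \<notin> K \<Longrightarrow> G x = 0"
    using admissible_support[OF adm] by blast
  show ?thesis unfolding hyp_energy_def
    by (rule integral_geo_ball[OF r compact_imp_closed[OF K(1)] K(2)])
       (auto intro!: continuous_intros poincare_factor_continuous admissible_continuous[OF adm] simp: K(4))
qed

lemma hyp_mass_has_integral:
  fixes u :: "real ^ 'n::finite \<Rightarrow> real"
  assumes r: "0 < r" and adm: "admissible r u G"
  shows "((\<lambda>x. if x \<in> geo_ball r then poincare_factor x ^ CARD('n) * (u x)\<^sup>2 else 0)
      has_integral hyp_mass r u) (cbox (- One) One)"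
proof -
  obtain K where K: "compact K" "K \<subseteq> geo_ball r"
    "\<And>x. x \<notin> K \<Longrightarrow> u x = 0" "\<And>x. x \<notin> K \<Longrightarrow> G x = 0"
    using admissible_support[OF adm] by blast
  show ?thesis unfolding hyp_mass_def
    by (rule integral_geo_ball[OF r compact_imp_closed[OF K(1)] K(2)])
       (auto intro!: continuous_intros poincare_factor_continuous admissible_continuous[OF adm] simp: K(3))
qed

lemma poincare_factor_pos: "x \<in> geo_ball r \<Longrightarrow> 0 < poincare_factor x"
  by (auto simp: geo_ball_def poincare_factor_def power_less_one_iff abs_square_less_1)

lemma hyp_energy_nonneg:
  assumes "0 < r" "admissible r u G"
  shows "0 \<le> hyp_energy r G"
  by (rule has_integral_nonneg[OF hyp_energy_has_integral[OF assms]])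
     (auto intro!: mult_nonneg_nonneg zero_le_power less_imp_le[OF poincare_factor_pos])

lemma hyp_mass_pos:
  fixes u :: "real ^ 'n::finite \<Rightarrow> real"
  assumes r: "0 < r" and adm: "admissible r u G" and x0: "u x0 \<noteq> 0"
  shows "0 < hyp_mass r u"
proof -
  obtain K where K: "compact K" "K \<subseteq> geo_ball r"
    "\<And>x. x \<notin> K \<Longrightarrow> u x = 0" "\<And>x. x \<notin> K \<Longrightarrow> G x = 0"
    using admissible_support[OF adm] by blast
  let ?m = "\<lambda>x. if x \<in> geo_ball r then poincare_factor x ^ CARD('n) * (u x)\<^sup>2 else 0"
  note int = hyp_mass_has_integral[OF r adm]
  have nn: "0 \<le> ?m x" for x
    using poincare_factor_pos[of x r] by (cases "x \<in> geo_ball r") simp_all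
  have "0 \<le> hyp_mass r u" by (rule has_integral_nonneg[OF int nn])
  moreover have "hyp_mass r u \<noteq> 0"
  proof
    assume "hyp_mass r u = 0"
    with int have int0: "(?m has_integral 0) (cbox (- One) One)" by simp
    have cont: "continuous_on UNIV ?m"
      by (rule extend_zero_continuous[OF open_geo_ball[OF r] compact_imp_closed[OF K(1)] K(2)])
         (auto intro!: continuous_intros poincare_factor_continuous admissible_continuous[OF adm] simp: K(3))
    have xb: "x0 \<in> geo_ball r" using x0 K by blast
    have "?m x0 = 0"
      by (rule has_integral_0_cbox_imp_0[OF continuous_on_subset[OF cont] nn int0])
         (use xb geo_ball_subset_cbox in \<open>auto simp: box_ne_empty\<close>)
    then show False using xb x0 poincare_factor_pos[OF xb] by simp
  qed
  ultimately show ?thesis by simp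
qed

section \<open>Rayleigh quotients of radial functions\<close>

definition conf_factor :: "real \<Rightarrow> real" where
  "conf_factor s = 2 / (1 - s)"

lemma poincare_factor_conf: "poincare_factor x = conf_factor ((norm x)\<^sup>2)"
  by (simp add: poincare_factor_def conf_factor_def)

lemma norm_sq_has_derivative:
  "((\<lambda>x. (norm x)\<^sup>2) has_derivative (\<lambda>h. 2 * (x \<bullet> h))) (at (x :: real ^ 'n))"
  unfolding power2_norm_eq_inner by (rule derivative_eq_intros refl)+ (simp add: inner_commute)

lemma radial_has_derivative:
  assumes "(F has_real_derivative F') (at ((norm x)\<^sup>2))"
  shows "((\<lambda>x. F ((norm x)\<^sup>2)) has_derivative (\<lambda>h. (2 * F') *\<^sub>R x \<bullet> h)) (at (x :: real ^ 'n))"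
proof -
  have "((\<lambda>x. F ((norm x)\<^sup>2)) has_derivative (\<lambda>h. F' * (2 * (x \<bullet> h)))) (at x)"
    by (rule has_derivative_compose[OF norm_sq_has_derivative, of F "\<lambda>y. F' * y"])
       (use assms in \<open>simp add: has_field_derivative_def\<close>)
  then show ?thesis by (simp add: mult_ac)
qed

text \<open>Picone's identity: for a radial field $F(|x|^2)\,x$ the divergence of $u^2 F x$ integrates to
  zero, and completing the square in the gradient of $u$ leaves exactly the Riccati expression.\<close>

lemma energy_ge_of_riccati:
  fixes u :: "real ^ 'n::finite \<Rightarrow> real"
  assumes r: "0 < r" and adm: "admissible r u G"
    and F: "\<And>s. 0 \<le> s \<Longrightarrow> s < euclid_radius_sq r \<Longrightarrow> (F has_real_derivative F' s) (at s)"
    and F': "continuous_on {0..<euclid_radius_sq r} F'"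
    and ineq: "\<And>s. 0 \<le> s \<Longrightarrow> s < euclid_radius_sq r \<Longrightarrow>
      real CARD('n) * F s + 2 * s * F' s + s * (F s)\<^sup>2 / conf_factor s ^ (CARD('n) - 2) + mu * conf_factor s ^ CARD('n) \<le> 0"
  shows "mu * hyp_mass r u \<le> hyp_energy r G"
proof -
  let ?n = "CARD('n)"  let ?B = "geo_ball r :: (real ^ 'n) set"  let ?s = "\<lambda>x :: real ^ 'n. (norm x)\<^sup>2"
  obtain K where K: "compact K" "K \<subseteq> ?B" "\<And>x. x \<notin> K \<Longrightarrow> u x = 0" "\<And>x. x \<notin> K \<Longrightarrow> G x = 0"
    using admissible_support[OF adm] by blast
  have B: "x \<in> ?B \<longleftrightarrow> ?s x < euclid_radius_sq r" for x by (simp add: geo_ball_eq[OF r])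
  define f where "f = (\<lambda>x. (u x)\<^sup>2 * F (?s x))"
  define g where "g = (\<lambda>x. (2 * u x * F (?s x)) *\<^sub>R G x + ((u x)\<^sup>2 * (2 * F' (?s x))) *\<^sub>R x)"
  have df: "(f has_derivative (\<lambda>h. g x \<bullet> h)) (at x)" if x: "x \<in> ?B" for x
  proof -
    have u: "(u has_derivative (\<lambda>h. G x \<bullet> h)) (at x)" using adm by (simp add: admissible_def)
    have "(f has_derivative (\<lambda>h. (u x)\<^sup>2 * ((2 * F' (?s x)) *\<^sub>R x \<bullet> h) + (of_nat 2 * (G x \<bullet> h) * u x ^ (2 - 1)) * F (?s x))) (at x)"
      unfolding f_def
      by (intro has_derivative_mult has_derivative_power u radial_has_derivative F) (use x B in auto)
    then show ?thesis unfolding g_def by (simp add: inner_add_left algebra_simps)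
  qed
  have Fc: "continuous_on {0..<euclid_radius_sq r} F"
    by (rule DERIV_continuous_on) (use F in \<open>auto intro: has_field_derivative_at_within\<close>)
  have cF: "continuous_on ?B (\<lambda>x. F (?s x))" "continuous_on ?B (\<lambda>x. F' (?s x))"
    by (intro continuous_on_compose2[OF Fc] continuous_on_compose2[OF F'] continuous_intros; use B in auto)+
  have cg: "continuous_on ?B g"
    unfolding g_def by (intro continuous_intros cF admissible_continuous[OF adm])
  let ?f = "\<lambda>x. if x \<in> ?B then f x else 0"  let ?g = "\<lambda>x. if x \<in> ?B then g x else 0"
  have z: "((\<lambda>x. real ?n * ?f x + ?g x \<bullet> x) has_integral 0) (cbox (- One) One)"
  proof (rule integral_radial_divergence)
    fix x
    have "(?f has_derivative (if x \<in> ?B then (\<lambda>h. g x \<bullet> h) else (\<lambda>h. 0))) (at x)"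
      by (rule extend_zero_derivative[OF open_geo_ball[OF r] compact_imp_closed[OF K(1)] K(2) df])
         (auto simp: f_def K(3))
    then show "(?f has_derivative (\<lambda>h. ?g x \<bullet> h)) (at x)" by (cases "x \<in> ?B") simp_all
  next
    show "continuous_on UNIV ?g"
      by (rule extend_zero_continuous[OF open_geo_ball[OF r] compact_imp_closed[OF K(1)] K(2) cg])
         (simp add: g_def K)
  next
    fix x :: "real ^ 'n" assume "1 \<le> norm x"
    then show "?f x = 0" by (simp add: geo_ball_def)
  qed
  let ?e = "\<lambda>x. if x \<in> ?B then poincare_factor x ^ (?n - 2) * (norm (G x))\<^sup>2 else 0"
  let ?m = "\<lambda>x. if x \<in> ?B then poincare_factor x ^ ?n * (u x)\<^sup>2 else 0"
  have "0 + mu * hyp_mass r u \<le> hyp_energy r G"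
  proof (rule has_integral_le[OF has_integral_add[OF z has_integral_mult_right[OF hyp_mass_has_integral[OF r adm]]]
        hyp_energy_has_integral[OF r adm]])
    fix x :: "real ^ 'n"
    show "real ?n * ?f x + ?g x \<bullet> x + mu * ?m x \<le> ?e x"
    proof (cases "x \<in> ?B")
      case True
      define s where "s = ?s x"
      have s: "0 \<le> s" "s < euclid_radius_sq r" unfolding s_def using True B by auto
      define c where "c = conf_factor s ^ (?n - 2)"
      have c: "c > 0" unfolding c_def conf_factor_def using s euclid_radius_sq_bounds[OF r] by simp
      define R where "R = real ?n * F s + 2 * s * F' s + s * (F s)\<^sup>2 / c + mu * conf_factor s ^ ?n"
      have R: "R \<le> 0" unfolding R_def c_def by (rule ineq[OF s])
      have "0 \<le> (norm (c *\<^sub>R G x - (u x * F s) *\<^sub>R x))\<^sup>2" by simp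
      also have "\<dots> = c\<^sup>2 * (norm (G x))\<^sup>2 - 2 * c * (u x * F s * (G x \<bullet> x)) + (u x)\<^sup>2 * (F s)\<^sup>2 * s"
        unfolding s_def power2_norm_eq_inner
        by (simp add: inner_diff_left inner_diff_right inner_commute algebra_simps power2_eq_square)
      also have "\<dots> = c * (c * (norm (G x))\<^sup>2 - 2 * (u x * F s * (G x \<bullet> x)) + (u x)\<^sup>2 * (s * (F s)\<^sup>2 / c))"
        using c by (simp add: algebra_simps power2_eq_square)
      finally have "0 \<le> c * (norm (G x))\<^sup>2 - 2 * (u x * F s * (G x \<bullet> x)) + (u x)\<^sup>2 * (s * (F s)\<^sup>2 / c)"
        using c by (simp add: zero_le_mult_iff)
      moreover have "(u x)\<^sup>2 * R \<le> 0" using R by (simp add: mult_nonneg_nonpos)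
      moreover have "(u x)\<^sup>2 * R = (u x)\<^sup>2 * (real ?n * F s + 2 * s * F' s + mu * conf_factor s ^ ?n)
          + (u x)\<^sup>2 * (s * (F s)\<^sup>2 / c)" unfolding R_def by (simp add: algebra_simps)
      moreover have "real ?n * f x + g x \<bullet> x + mu * (poincare_factor x ^ ?n * (u x)\<^sup>2)
          = (u x)\<^sup>2 * (real ?n * F s + 2 * s * F' s + mu * conf_factor s ^ ?n) + 2 * (u x * F s * (G x \<bullet> x))"
      proof -
        have xx: "x \<bullet> x = s" by (simp add: s_def power2_norm_eq_inner)
        show ?thesis unfolding f_def g_def poincare_factor_conf s_def[symmetric]
          by (simp add: inner_add_left xx algebra_simps)
      qed
      ultimately have "real ?n * f x + g x \<bullet> x + mu * (poincare_factor x ^ ?n * (u x)\<^sup>2) \<le> c * (norm (G x))\<^sup>2"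
        by linarith
      then show ?thesis using True by (simp add: c_def s_def poincare_factor_conf)
    qed simp
  qed
  then show ?thesis by simp
qed

text \<open>The Euclidean divergence of P(|x|^2) x is n P + 2 s P' and integrates to zero, so a
  pointwise inequality modulo this divergence bounds the Rayleigh quotient. The gap between S and
  the radius of the ball makes the support compact inside it.\<close>

lemma radial_test_function:
  fixes U U' P P' :: "real \<Rightarrow> real"
  assumes r: "0 < r" and S: "0 < S" "S < euclid_radius_sq r"
    and U: "\<And>s. 0 \<le> s \<Longrightarrow> (U has_real_derivative U' s) (at s)" "continuous_on {0..} U'"
    and P: "\<And>s. 0 \<le> s \<Longrightarrow> (P has_real_derivative P' s) (at s)" "continuous_on {0..} P'"
    and z: "\<And>s. S \<le> s \<Longrightarrow> U s = 0 \<and> U' s = 0 \<and> P s = 0 \<and> P' s = 0"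
    and ineq: "\<And>s. 0 \<le> s \<Longrightarrow> s < S \<Longrightarrow>
      conf_factor s ^ (CARD('n::finite) - 2) * (4 * s * (U' s)\<^sup>2) - mu * conf_factor s ^ CARD('n) * (U s)\<^sup>2
        \<le> real CARD('n) * P s + 2 * s * P' s"
  defines "u \<equiv> \<lambda>x :: real ^ 'n. U ((norm x)\<^sup>2)" and "G \<equiv> \<lambda>x :: real ^ 'n. (2 * U' ((norm x)\<^sup>2)) *\<^sub>R x"
  shows "admissible r u G" and "hyp_energy r G \<le> mu * hyp_mass r u"
proof -
  let ?n = "CARD('n)"  let ?s = "\<lambda>x :: real ^ 'n. (norm x)\<^sup>2"
  let ?B = "geo_ball r :: (real ^ 'n) set"
  have S1: "S < 1" using S euclid_radius_sq_bounds[OF r] by simp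
  have cont: "continuous_on UNIV (\<lambda>x. (2 * H (?s x)) *\<^sub>R x)" if "continuous_on {0..} H" for H :: "real \<Rightarrow> real"
    by (intro continuous_intros continuous_on_compose2[OF that]) auto
  let ?K = "{x. ?s x \<le> S}"
  have "closed ?K" by (intro closed_Collect_le continuous_intros)
  moreover have "bounded ?K"
  proof (rule bounded_subset[OF bounded_cball])
    show "?K \<subseteq> cball 0 1"
    proof
      fix x :: "real ^ 'n" assume "x \<in> ?K"
      then have "(norm x)\<^sup>2 \<le> 1" using S1 by simp
      then have "\<bar>norm x\<bar> \<le> 1" by (simp only: abs_square_le_1)
      then show "x \<in> cball 0 1" by simp
    qed
  qed
  ultimately have K: "compact ?K" by (simp add: compact_eq_bounded_closed)
  have clos: "closure {x. u x \<noteq> 0} \<subseteq> ?K"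
  proof (rule closure_minimal)
    show "{x. u x \<noteq> 0} \<subseteq> ?K" unfolding u_def using z by (auto simp: not_le intro: less_imp_le) (meson linear)
  qed (use \<open>closed ?K\<close> in simp)
  have compact: "compact (closure {x. u x \<noteq> 0})"
    using compact_Int_closed[OF K closed_closure, of "{x. u x \<noteq> 0}"] clos by (simp add: Int_absorb1)
  show adm: "admissible r u G"
    unfolding admissible_def
  proof (intro conjI allI)
    show "(u has_derivative (\<lambda>h. G x \<bullet> h)) (at x)" for x
      unfolding u_def G_def by (rule radial_has_derivative) (simp add: U(1))
    show "continuous_on UNIV G" unfolding G_def by (rule cont[OF U(2)])
    show "compact (closure {x. u x \<noteq> 0})" by (rule compact)
    show "closure {x. u x \<noteq> 0} \<subseteq> ?B" using clos S by (auto simp: geo_ball_eq[OF r])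
  qed
  have div: "((\<lambda>x. real ?n * P (?s x) + (2 * P' (?s x)) *\<^sub>R x \<bullet> x) has_integral 0) (cbox (- One) One)"
  proof (rule integral_radial_divergence)
    show "((\<lambda>x. P (?s x)) has_derivative (\<lambda>h. (2 * P' (?s x)) *\<^sub>R x \<bullet> h)) (at x)" for x
      by (rule radial_has_derivative) (simp add: P(1))
    show "continuous_on UNIV (\<lambda>x. (2 * P' (?s x)) *\<^sub>R x)" by (rule cont[OF P(2)])
    fix x :: "real ^ 'n" assume "1 \<le> norm x"
    then have "1 \<le> ?s x" by simp
    then show "P (?s x) = 0" using z[of "?s x"] S1 by simp
  qed
  have "hyp_energy r G \<le> 0 + mu * hyp_mass r u"
  proof (rule has_integral_le[OF hyp_energy_has_integral[OF r adm]
        has_integral_add[OF div has_integral_mult_right[OF hyp_mass_has_integral[OF r adm]]]])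
    fix x :: "real ^ 'n"
    define s where "s = ?s x"
    have xx: "x \<bullet> x = s" by (simp add: s_def power2_norm_eq_inner)
    have s0: "0 \<le> s" by (simp add: s_def)
    have G2: "(norm (G x))\<^sup>2 = 4 * s * (U' s)\<^sup>2"
      unfolding G_def power2_norm_eq_inner xx[symmetric] s_def[symmetric]
      by (simp add: power2_eq_square algebra_simps xx s_def[symmetric])
    show "(if x \<in> ?B then poincare_factor x ^ (?n - 2) * (norm (G x))\<^sup>2 else 0)
       \<le> real ?n * P (?s x) + (2 * P' (?s x)) *\<^sub>R x \<bullet> x + mu * (if x \<in> ?B then poincare_factor x ^ ?n * (u x)\<^sup>2 else 0)"
    proof (cases "s < S")
      case True
      then have xB: "x \<in> ?B" using S by (simp add: geo_ball_eq[OF r] s_def)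
      have "conf_factor s ^ (?n - 2) * (4 * s * (U' s)\<^sup>2) \<le> real ?n * P s + 2 * s * P' s + mu * conf_factor s ^ ?n * (U s)\<^sup>2"
        using ineq[OF s0 True] by linarith
      then show ?thesis using xB G2
        by (simp add: poincare_factor_conf u_def s_def[symmetric] xx mult_ac)
    next
      case False
      then have "U s = 0" "U' s = 0" "P s = 0" "P' s = 0" using z[of s] by auto
      then show ?thesis using G2 by (simp add: u_def s_def[symmetric])
    qed
  qed
  then show "hyp_energy r G \<le> mu * hyp_mass r u" by simp
qed

section \<open>Bounding the infimum from both sides\<close>

lemma lambda1_hyp_le:
  fixes u :: "real ^ 'n::finite \<Rightarrow> real"
  assumes r: "0 < r" and adm: "admissible r u G" and x0: "u x0 \<noteq> 0"
    and le: "hyp_energy r G \<le> mu * hyp_mass r u"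
  shows "lambda1_hyp TYPE('n) r \<le> mu"
proof -
  let ?A = "{hyp_energy r G / hyp_mass r u | u G :: real ^ 'n \<Rightarrow> _.
       admissible r u G \<and> (\<exists>x. u x \<noteq> 0)}"
  have "bdd_below ?A"
  proof (rule bdd_belowI)
    fix q assume "q \<in> ?A"
    then obtain u and G :: "real ^ 'n \<Rightarrow> real ^ 'n" where q: "q = hyp_energy r G / hyp_mass r u"
      and a: "admissible r u G" "\<exists>x. u x \<noteq> 0" by auto
    then show "0 \<le> q" using hyp_energy_nonneg[OF r a(1)] hyp_mass_pos[OF r a(1)]
      by (auto intro: divide_nonneg_pos)
  qed
  then have "Inf ?A \<le> hyp_energy r G / hyp_mass r u" by (rule cInf_lower[rotated]) (use adm x0 in auto)
  also have "\<dots> \<le> mu" using le hyp_mass_pos[where u = u and G = G, OF r adm x0] by (simp add: divide_le_eq)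
  finally show ?thesis by (simp add: lambda1_hyp_def)
qed

text \<open>\<open>Inf\<close> of the empty set carries no information, so a nonzero admissible
  function is supplied along with the energy inequality. The subsolution argument will provide
  it.\<close>

lemma lambda1_hyp_ge:
  fixes v :: "real ^ 'n::finite \<Rightarrow> real"
  assumes r: "0 < r" and ex: "admissible r v H" "v x0 \<noteq> 0"
    and ge: "\<And>(u :: real ^ 'n \<Rightarrow> real) G. admissible r u G \<Longrightarrow> mu * hyp_mass r u \<le> hyp_energy r G"
  shows "mu \<le> lambda1_hyp TYPE('n) r"
  unfolding lambda1_hyp_def
proof (rule cInf_greatest)
  fix q assume "q \<in> {hyp_energy r G / hyp_mass r u | u G :: real ^ 'n \<Rightarrow> _.
       admissible r u G \<and> (\<exists>x. u x \<noteq> 0)}"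
  then obtain u and G :: "real ^ 'n \<Rightarrow> real ^ 'n" where q: "q = hyp_energy r G / hyp_mass r u"
      and a: "admissible r u G" "\<exists>x. u x \<noteq> 0" by auto
  obtain y where "u y \<noteq> 0" using a(2) by blast
  then have "0 < hyp_mass r u" by (rule hyp_mass_pos[OF r a(1)])
  then show "mu \<le> q" using ge[OF a(1)] by (simp add: q le_divide_eq)
qed (use ex in auto)

section \<open>Powers truncated at the first zero\<close>

lemma truncated_powr_continuous:
  fixes W k :: "real \<Rightarrow> real"
  assumes W: "continuous_on {0..S} W" "\<And>s. 0 \<le> s \<Longrightarrow> s < S \<Longrightarrow> 0 < W s" "W S = 0"
    and k: "continuous_on {0..S} k" and b: "0 < b"
  shows "continuous_on {0..} (\<lambda>s. if s < S then W s powr b * k s else 0)"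
proof -
  have "continuous_on {0..} (\<lambda>s. if s \<le> S then W s powr b * k s else 0)"
  proof (rule continuous_on_cases_le)
    have e: "{x \<in> {0..}. x \<le> S} = {0..S}" by auto
    have "continuous_on {0..S} (\<lambda>s. W s powr b)"
    proof (rule continuous_on_powr'[OF W(1) continuous_on_const], rule ballI)
      fix s assume "s \<in> {0..S}"
      then show "0 \<le> W s \<and> (W s = 0 \<longrightarrow> 0 < b)" using W(2)[of s] W(3) b by (cases "s = S") auto
    qed
    then show "continuous_on {x \<in> {0..}. x \<le> S} (\<lambda>s. W s powr b * k s)"
      unfolding e by (intro continuous_on_mult k)
  qed (use W(3) in \<open>auto intro!: continuous_intros\<close>)
  then show ?thesis by (rule continuous_on_eq) (use W(3) in auto)
qed

text \<open>The delicate point is S itself: from the left the difference quotient is that of W, with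
  limit W'(S), times W^(a-1) h, which tends to 0 because a > 1. Hence the two pieces fit together
  with derivative 0.\<close>

lemma truncated_powr_deriv:
  fixes W h :: "real \<Rightarrow> real"
  assumes W: "\<And>s. 0 \<le> s \<Longrightarrow> s \<le> S \<Longrightarrow> (W has_real_derivative W' s) (at s)"
    and h: "\<And>s. 0 \<le> s \<Longrightarrow> s \<le> S \<Longrightarrow> (h has_real_derivative h' s) (at s)"
    and pos: "\<And>s. 0 \<le> s \<Longrightarrow> s < S \<Longrightarrow> 0 < W s" "W S = 0"
    and a: "1 < a" and S: "0 < S" and s: "0 \<le> s"
  shows "((\<lambda>s. if s < S then W s powr a * h s else 0) has_real_derivative
     (if s < S then a * W s powr (a - 1) * W' s * h s + W s powr a * h' s else 0)) (at s)"
proof -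
  let ?V = "\<lambda>s. if s < S then W s powr a * h s else 0"
  consider "s < S" | "s = S" | "s > S" by linarith
  then show ?thesis
  proof cases
    case 1
    have "((\<lambda>s. W s powr a) has_real_derivative a * W s powr (a - 1) * W' s) (at s)"
      using DERIV_chain2[OF has_real_derivative_powr[OF pos(1)[OF s 1], of a] W[OF s less_imp_le[OF 1]]] .
    then have "((\<lambda>s. W s powr a * h s) has_real_derivative
        a * W s powr (a - 1) * W' s * h s + h' s * W s powr a) (at s)"
      by (rule DERIV_mult[OF _ h[OF s less_imp_le[OF 1]]])
    then have "(?V has_real_derivative a * W s powr (a - 1) * W' s * h s + h' s * W s powr a) (at s)"
      by (rule has_field_derivative_transform_within_open[of _ _ _ "{..<S}"]) (use 1 in auto)
    then show ?thesis using 1 by (simp add: mult.commute[of "h' s"])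
  next
    case 2
    let ?R = "\<lambda>s. if s < S then W s powr (a - 1) * h s else 0"
    have Wc: "continuous_on {0..S} W" "continuous_on {0..S} h"
      by (rule DERIV_continuous_on, rule has_field_derivative_at_within, rule W; simp)
         (rule DERIV_continuous_on, rule has_field_derivative_at_within, rule h; simp)
    have "continuous_on {0..} ?R"
      by (rule truncated_powr_continuous[OF Wc(1) pos Wc(2)]) (use a in auto)
    then have "continuous_on {0<..} ?R" by (rule continuous_on_subset) auto
    then have "isCont ?R S" using S by (simp add: continuous_on_eq_continuous_at)
    then have R: "(?R \<longlongrightarrow> 0) (at S)" by (simp add: isCont_def)
    have "((\<lambda>y. (W y - W S) / (y - S)) \<longlongrightarrow> W' S) (at S)"
      using W[of S] S by (simp add: has_field_derivative_iff)
    from tendsto_mult[OF this R]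
    have lim: "((\<lambda>y. (W y - W S) / (y - S) * ?R y) \<longlongrightarrow> 0) (at S)" by simp
    have "((\<lambda>y. (?V y - ?V S) / (y - S)) \<longlongrightarrow> 0) (at S)"
    proof (rule Lim_transform_within_open[OF lim, of "{0<..}"])
      fix y assume y: "y \<in> {0<..}" "y \<noteq> S"
      show "(W y - W S) / (y - S) * ?R y = (?V y - ?V S) / (y - S)"
      proof (cases "y < S")
        case True
        then have "W y * W y powr (a - 1) = W y powr a"
          using powr_mult_base[of "W y" "a - 1"] pos(1)[of y] y by simp
        then have "W y * (W y powr (a - 1) * h y) = W y powr a * h y" by (simp flip: mult.assoc)
        then show ?thesis using True pos(2) by simp
      qed simp
    qed (use S in auto)
    then show ?thesis using 2 by (simp add: has_field_derivative_iff)
  next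
    case 3
    have "(?V has_real_derivative 0) (at s)"
      by (rule has_field_derivative_transform_within_open[of "\<lambda>_. 0" _ _ "{S<..}"]) (use 3 in auto)
    then show ?thesis using 3 by simp
  qed
qed

section \<open>Comparison with supersolutions and subsolutions\<close>

text \<open>Picone's field is taken to be rho^(n-2) grad w / w with w = (1-s)^p X and rho the
  conformal factor; its Riccati expression is a positive multiple of the residual of X.\<close>

lemma energy_ge_of_supersolution:
  fixes u :: "real ^ 'n::finite \<Rightarrow> real" and m :: nat
  assumes r: "0 < r" and dim: "CARD('n) = 2 * m + 2" and adm: "admissible r u G"
    and X: "\<And>s. s < 1 \<Longrightarrow> (X has_real_derivative N s / (1 - s)) (at s)"
    and N: "\<And>s. s < 1 \<Longrightarrow> (N has_real_derivative N' s) (at s)" "continuous_on {..<1} N'"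
    and pos: "\<And>s. 0 \<le> s \<Longrightarrow> s < euclid_radius_sq r \<Longrightarrow> 0 < X s"
    and res: "\<And>s. 0 \<le> s \<Longrightarrow> s < euclid_radius_sq r \<Longrightarrow>
       s * N' s + (real m + 1) * N s - (real m + 1/2) / 2 * X s + lam\<^sup>2 / (1 - s) * X s \<le> 0"
  shows "((real m + 1/2)\<^sup>2 + lam\<^sup>2) * hyp_mass r u \<le> hyp_energy r G"
proof -
  define p where "p = real m + 1/2"
  \<comment> \<open>\<open>v\<close> is (1-s) w'/w for w = (1-s)^p X. As grad w = 2 w' x and
    rho^(2m) = 2^(2m) / (1-s)^(2m), the radial coefficient of rho^(n-2) grad w / w is the function
    \<open>F\<close> below.\<close>
  define v where "v = (\<lambda>s. N s / X s - p)"
  define v' where "v' = (\<lambda>s. N' s / X s - (N s)\<^sup>2 / ((1 - s) * (X s)\<^sup>2))"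
  define t where "t = (2::real) ^ (2 * m)"
  define F where "F = (\<lambda>s. 2 * t * (v s / (1 - s) ^ (2 * m + 1)))"
  define F' where "F' = (\<lambda>s. 2 * t * (v' s / (1 - s) ^ (2 * m + 1) + (2 * real m + 1) * v s / (1 - s) ^ (2 * m + 2)))"
  have t: "t > 0" unfolding t_def by simp
  have S1: "euclid_radius_sq r < 1" by (rule euclid_radius_sq_bounds[OF r])
  have "(p\<^sup>2 + lam\<^sup>2) * hyp_mass r u \<le> hyp_energy r G"
  proof (rule energy_ge_of_riccati[OF r adm])
    fix s assume s: "0 \<le> s" "s < euclid_radius_sq r"
    then have s1: "s < 1" using S1 by simp
    have Xp: "X s > 0" using pos s by blast
    have dv: "(v has_real_derivative v' s) (at s)"
    proof -
      have "(v has_real_derivative (N' s * X s - N s * (N s / (1 - s))) / (X s * X s) - 0) (at s)"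
        unfolding v_def using Xp by (intro DERIV_diff DERIV_divide N X s1 DERIV_const) auto
      moreover have "(N' s * X s - N s * (N s / (1 - s))) / (X s * X s) - 0 = v' s"
        unfolding v'_def using Xp s1 by (simp add: field_simps power2_eq_square)
      ultimately show ?thesis by simp
    qed
    have dq: "((\<lambda>s. (1 - s) ^ (2 * m + 1)) has_real_derivative - (real (2 * m + 1) * (1 - s) ^ (2 * m))) (at s)"
      by (rule derivative_eq_intros refl)+ simp
    define q where "q = 1 - s"
    define k where "k = q ^ (2 * m + 1)"
    have q: "q > 0" unfolding q_def using s1 by simp
    have k: "k > 0" unfolding k_def using q by simp
    have q1: "q ^ (2 * m) = k / q" "q ^ (2 * m + 2) = k * q" unfolding k_def using q by auto
    show "(F has_real_derivative F' s) (at s)"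
    proof -
      have "((\<lambda>s. v s / (1 - s) ^ (2 * m + 1)) has_real_derivative
         (v' s * k - v s * - (real (2 * m + 1) * (k / q))) / (k * k)) (at s)"
        using DERIV_divide[OF dv dq] q k unfolding q_def[symmetric] k_def[symmetric] q1 by simp
      then have "(F has_real_derivative 2 * t * ((v' s * k - v s * - (real (2 * m + 1) * (k / q))) / (k * k))) (at s)"
        unfolding F_def by (rule DERIV_cmult)
      moreover have "2 * t * ((v' s * k - v s * - (real (2 * m + 1) * (k / q))) / (k * k)) = F' s"
        unfolding F'_def q_def[symmetric] q1 unfolding k_def[symmetric] using q k by (simp add: field_simps)
      ultimately show ?thesis by simp
    qed
    have c: "conf_factor s ^ (CARD('n) - 2) = t * q / k" "conf_factor s ^ CARD('n) = 4 * t / (k * q)"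
    proof -
      have "conf_factor s ^ (CARD('n) - 2) = 2 ^ (2 * m) / q ^ (2 * m)"
        unfolding conf_factor_def dim q_def[symmetric] by (simp add: power_divide)
      then show "conf_factor s ^ (CARD('n) - 2) = t * q / k" unfolding q1 t_def using q k by simp
      have "conf_factor s ^ CARD('n) = 2 ^ (2 * m + 2) / q ^ (2 * m + 2)"
        unfolding conf_factor_def dim q_def[symmetric] by (simp only: power_divide)
      then show "conf_factor s ^ CARD('n) = 4 * t / (k * q)" unfolding q1 t_def by simp
    qed
    define z where "z = N s / X s"
    define y where "y = N' s / X s"
    have vz: "v s = z - p" "v' s = y - z\<^sup>2 / q"
      unfolding v_def v'_def z_def y_def q_def by (auto simp: power_divide)
    have Fs: "F s = 2 * t * (z - p) / k"
      "F' s = 2 * t * ((y - z\<^sup>2 / q) / k + (2 * real m + 1) * (z - p) / (k * q))"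
      unfolding F_def F'_def q_def[symmetric] vz q1 unfolding k_def[symmetric] by simp_all
    have "real CARD('n) * F s + 2 * s * F' s + s * (F s)\<^sup>2 / conf_factor s ^ (CARD('n) - 2) + (p\<^sup>2 + lam\<^sup>2) * conf_factor s ^ CARD('n)
      = 4 * t / (k * q) * ((real m + 1) * q * (z - p) + s * (y * q - z\<^sup>2) + s * (2 * real m + 1) * (z - p)
          + s * (z - p)\<^sup>2 + p\<^sup>2 + lam\<^sup>2)"
    proof -
      have "s * (F s)\<^sup>2 / (t * q / k) = 4 * t / (k * q) * (s * (z - p)\<^sup>2)"
        unfolding Fs using t q k by (simp add: field_simps power2_eq_square)
      moreover have "real CARD('n) * F s = 4 * t / (k * q) * ((real m + 1) * q * (z - p))"
        unfolding Fs dim using q k by (simp add: field_simps)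
      moreover have "2 * s * F' s = 4 * t / (k * q) * (s * (y * q - z\<^sup>2) + s * (2 * real m + 1) * (z - p))"
        unfolding Fs using q k by (simp add: field_simps)
      ultimately show ?thesis unfolding c by (simp add: distrib_left mult.commute add.assoc)
    qed
    \<comment> \<open>The squares of z cancel, so the Riccati expression becomes linear in N, N' and
      X after multiplication by X. Here 2 p = 2 m + 1 removes the terms s p z, and p^2 - (m+1) p =
      -p/2 yields the coefficient of X.\<close>
    also have "(real m + 1) * q * (z - p) + s * (y * q - z\<^sup>2) + s * (2 * real m + 1) * (z - p)
          + s * (z - p)\<^sup>2 + p\<^sup>2 + lam\<^sup>2 = q * (s * y + (real m + 1) * z - p / 2) + lam\<^sup>2"
      unfolding p_def q_def by (simp add: field_simps power2_eq_square)
    also have "\<dots> = q / X s * (s * N' s + (real m + 1) * N s - p / 2 * X s + lam\<^sup>2 / (1 - s) * X s)"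
      unfolding y_def z_def q_def[symmetric] using q Xp by (simp add: field_simps)
    also have "4 * t / (k * q) * \<dots> \<le> 0"
      using res[OF s] t k q Xp unfolding p_def[symmetric] by (intro mult_nonneg_nonpos) auto
    finally show "real CARD('n) * F s + 2 * s * F' s + s * (F s)\<^sup>2 / conf_factor s ^ (CARD('n) - 2)
        + (p\<^sup>2 + lam\<^sup>2) * conf_factor s ^ CARD('n) \<le> 0" .
  next
    have cN: "continuous_on {0..<euclid_radius_sq r} N"
      by (rule DERIV_continuous_on[OF has_field_derivative_at_within[OF N(1)]]) (use S1 in simp)
    have cX: "continuous_on {0..<euclid_radius_sq r} X"
      by (rule DERIV_continuous_on[OF has_field_derivative_at_within[OF X]]) (use S1 in simp)
    have cN': "continuous_on {0..<euclid_radius_sq r} N'"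
      by (rule continuous_on_subset[OF N(2)]) (use S1 in auto)
    show "continuous_on {0..<euclid_radius_sq r} F'"
      unfolding F'_def v_def v'_def
      by (intro continuous_intros cN cX cN') (use S1 pos in \<open>auto simp: less_imp_neq[symmetric]\<close>)
  qed
  then show ?thesis by (simp add: p_def)
qed

text \<open>The natural test function, the positive part of w = (1-s)^p X, may have a corner at S,
  whereas admissible functions are C^1. The power 1 + e smooths the corner at the price of a factor
  that tends to 1 as e tends to 0. The first conclusion is the nonemptiness needed for the lower
  bound.\<close>

lemma lambda1_hyp_le_of_subsolution:
  fixes m :: nat
  assumes r: "0 < r" and dim: "CARD('n::finite) = 2 * m + 2" and S: "0 < S" "S < euclid_radius_sq r"
    and X: "\<And>s. s < 1 \<Longrightarrow> (X has_real_derivative N s / (1 - s)) (at s)"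
    and N: "\<And>s. s < 1 \<Longrightarrow> (N has_real_derivative N' s) (at s)" "continuous_on {..<1} N'"
    and pos: "\<And>s. 0 \<le> s \<Longrightarrow> s < S \<Longrightarrow> 0 < X s" "X S = 0"
    and res: "\<And>s. 0 \<le> s \<Longrightarrow> s < S \<Longrightarrow>
       0 \<le> s * N' s + (real m + 1) * N s - (real m + 1/2) / 2 * X s + lam\<^sup>2 / (1 - s) * X s"
  shows "\<exists>(u :: real ^ 'n \<Rightarrow> real) G x. admissible r u G \<and> u x \<noteq> 0"
    and "lambda1_hyp TYPE('n) r \<le> (real m + 1/2)\<^sup>2 + lam\<^sup>2"
proof -
  define p where "p = real m + 1/2"
  define mu where "mu = p\<^sup>2 + lam\<^sup>2"
  define t where "t = (2::real) ^ (2 * m)"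
  define Q where "Q = (\<lambda>s::real. (1 - s) powr (- p))"
  define W where "W = (\<lambda>s. (1 - s) powr p * X s)"
  define W' where "W' = (\<lambda>s. (1 - s) powr (p - 1) * (N s - p * X s))"
  \<comment> \<open>The field f x is rho^(n-2) grad W; its radial coefficient simplifies because 2 p
    = 2 m + 1. Property \<open>key\<close> below is then the subsolution inequality in divergence
    form, div (f x) + mu rho^n W >= 0.\<close>
  define f where "f = (\<lambda>s. 2 * t * Q s * (N s - p * X s))"
  define f' where "f' = (\<lambda>s. 2 * t * Q s * (N' s - p\<^sup>2 * X s / (1 - s)))"
  have S1: "S < 1" using S euclid_radius_sq_bounds[OF r] by simp
  have t: "t > 0" unfolding t_def by simp
  have cX: "continuous_on {0..S} X" and cN: "continuous_on {0..S} N" and cN': "continuous_on {0..S} N'"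
  proof -
    show "continuous_on {0..S} X"
      by (rule DERIV_continuous_on[OF has_field_derivative_at_within[OF X]]) (use S1 in simp)
    show "continuous_on {0..S} N"
      by (rule DERIV_continuous_on[OF has_field_derivative_at_within[OF N(1)]]) (use S1 in simp)
    show "continuous_on {0..S} N'" by (rule continuous_on_subset[OF N(2)]) (use S1 in auto)
  qed
  have dpow: "((\<lambda>s. (1 - s) powr a) has_real_derivative - a * (1 - s) powr (a - 1)) (at s)" if "s < 1" for a s :: real
    by (rule derivative_eq_intros refl | use that in simp)+
  have dW: "(W has_real_derivative W' s) (at s)" if s: "s < 1" for s
  proof -
    have "(W has_real_derivative (- p * (1 - s) powr (p - 1)) * X s + N s / (1 - s) * (1 - s) powr p) (at s)"
      unfolding W_def by (rule DERIV_mult[OF dpow[OF s] X[OF s]])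
    moreover have "(1 - s) powr p = (1 - s) powr (p - 1) * (1 - s)"
      using powr_mult_base[of "1 - s" "p - 1"] s by (simp add: mult.commute)
    moreover have "(- p * a) * X s + N s / (1 - s) * (a * (1 - s)) = a * (N s - p * X s)" for a
    proof -
      have "N s / (1 - s) * (a * (1 - s)) = a * N s" using s by simp
      then show ?thesis by (simp only: right_diff_distrib) simp
    qed
    ultimately show ?thesis by (simp only: W'_def)
  qed
  have df: "(f has_real_derivative f' s) (at s)" if s: "s < 1" for s
  proof -
    have "(Q has_real_derivative p * (Q s / (1 - s))) (at s)"
      using dpow[OF s, of "- p"] powr_diff[of "1 - s" "- p" 1] s unfolding Q_def by simp
    then have "((\<lambda>s. 2 * t * Q s) has_real_derivative 2 * t * (p * (Q s / (1 - s)))) (at s)"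
      by (rule DERIV_cmult)
    moreover have "((\<lambda>s. N s - p * X s) has_real_derivative N' s - p * (N s / (1 - s))) (at s)"
      by (intro DERIV_diff DERIV_cmult N X s)
    ultimately have "(f has_real_derivative
       2 * t * (p * (Q s / (1 - s))) * (N s - p * X s) + (N' s - p * (N s / (1 - s))) * (2 * t * Q s)) (at s)"
      unfolding f_def by (rule DERIV_mult)
    moreover have "2 * t * (p * (Q s / (1 - s))) * (N s - p * X s) + (N' s - p * (N s / (1 - s))) * (2 * t * Q s)
       = f' s"
    proof -
      have "2 * t * (p * (Q / q)) * (N - p * X) + (N' - p * (N / q)) * (2 * t * Q) = 2 * t * Q * (N' - p\<^sup>2 * X / q)"
        for Q q N N' X :: real by (simp add: divide_inverse algebra_simps power2_eq_square)
      then show ?thesis unfolding f'_def .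
    qed
    ultimately show ?thesis by simp
  qed
  have Wpos: "0 < W s" if "0 \<le> s" "s < S" for s
    unfolding W_def using pos(1)[OF that] that S1 by simp
  have WS: "W S = 0" unfolding W_def using pos by simp
  have cW: "continuous_on {0..S} W" and cW': "continuous_on {0..S} W'"
    and cf: "continuous_on {0..S} f" and cf': "continuous_on {0..S} f'"
    unfolding W_def W'_def f_def f'_def Q_def using S1
    by (auto intro!: continuous_intros cX cN cN')
  have conf: "f s = 2 * conf_factor s ^ (2 * m) * W' s"
    and key: "0 \<le> (2 * real m + 2) * f s + 2 * s * f' s + mu * conf_factor s ^ (2 * m + 2) * W s"
    if s: "0 \<le> s" "s < S" for s
  proof -
    define q where "q = 1 - s"
    have q: "q > 0" unfolding q_def using s S1 by simp
    have qp: "q powr (p - 1) = Q s * q ^ (2 * m)" "q powr p = Q s * q ^ (2 * m + 1)"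
    proof -
      have "Q s * q ^ (2 * m) = q powr (- p + real (2 * m))"
        unfolding Q_def q_def[symmetric] using q by (simp only: powr_add powr_realpow)
      moreover have "- p + real (2 * m) = p - 1" unfolding p_def by simp
      ultimately show "q powr (p - 1) = Q s * q ^ (2 * m)" by simp
      have "Q s * q ^ (2 * m + 1) = q powr (- p + real (2 * m + 1))"
        unfolding Q_def q_def[symmetric] using q by (simp only: powr_add powr_realpow)
      moreover have "- p + real (2 * m + 1) = p" unfolding p_def by simp
      ultimately show "q powr p = Q s * q ^ (2 * m + 1)" by simp
    qed
    have c: "conf_factor s ^ (2 * m) = t / q ^ (2 * m)" "conf_factor s ^ (2 * m + 2) = 4 * t / (q ^ (2 * m + 1) * q)"
      unfolding conf_factor_def t_def q_def[symmetric] by (simp_all add: power_divide)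
    show "f s = 2 * conf_factor s ^ (2 * m) * W' s"
      unfolding f_def W'_def c q_def[symmetric] qp using q by simp
    have "(2 * real m + 2) * f s + 2 * s * f' s + mu * conf_factor s ^ (2 * m + 2) * W s
      = 4 * t * Q s * ((real m + 1) * (N s - p * X s) + s * (N' s - p\<^sup>2 * X s / q) + mu * X s / q)"
    proof -
      have "conf_factor s ^ (2 * m + 2) * W s = 4 * t * Q s * (X s / q)"
        unfolding c W_def q_def[symmetric] qp using q by simp
      then show ?thesis unfolding f_def f'_def q_def[symmetric] by (simp add: algebra_simps)
    qed
    also have "(real m + 1) * (N s - p * X s) + s * (N' s - p\<^sup>2 * X s / q) + mu * X s / q
       = s * N' s + (real m + 1) * N s - p / 2 * X s + lam\<^sup>2 / q * X s"
    proof -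
      have sq: "1 - q = s" by (simp add: q_def)
      have "(1 - q) * (a / q) = a / q - a" for a using q by (simp add: field_simps)
      then have "s * (p\<^sup>2 * X s / q) = p\<^sup>2 * X s / q - p\<^sup>2 * X s" by (simp only: sq)
      moreover have "(real m + 1) * (p * X s) = p\<^sup>2 * X s + p / 2 * X s"
        unfolding p_def by (simp add: field_simps power2_eq_square)
      moreover have "mu * X s / q = p\<^sup>2 * X s / q + lam\<^sup>2 / q * X s"
        unfolding mu_def by (simp add: add_divide_distrib distrib_right)
      ultimately show ?thesis by (simp add: right_diff_distrib)
    qed
    also have "0 \<le> 4 * t * Q s * \<dots>"
      using res[OF s] t unfolding p_def[symmetric] q_def[symmetric] Q_def by (intro mult_nonneg_nonneg) auto
    finally show "0 \<le> (2 * real m + 2) * f s + 2 * s * f' s + mu * conf_factor s ^ (2 * m + 2) * W s" .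
  qed
  have test: "\<exists>(u :: real ^ 'n \<Rightarrow> real) G x. admissible r u G \<and> u x \<noteq> 0
      \<and> hyp_energy r G \<le> ((1 + e)\<^sup>2 / (1 + 2 * e) * mu) * hyp_mass r u" if e: "0 < e" for e
  proof -
    define c where "c = (1 + e)\<^sup>2 / (1 + 2 * e)"
    have c: "c > 0" unfolding c_def using e by simp
    have ce: "c * (1 + 2 * e) = (1 + e)\<^sup>2" unfolding c_def using e by simp
    define U where "U = (\<lambda>s. if s < S then W s powr (1 + e) * 1 else 0)"
    define U' where "U' = (\<lambda>s. if s < S then (1 + e) * W s powr ((1 + e) - 1) * W' s * 1 + W s powr (1 + e) * 0 else 0)"
    \<comment> \<open>This is the flux that arises when the subsolution inequality is multiplied by
      W^(1+2e) and integrated by parts. The constant \<open>c\<close> makes the gradient part of its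
      divergence equal to the energy density of W^(1+e): c (1 + 2e) = (1 + e)^2.\<close>
    define P where "P = (\<lambda>s. if s < S then W s powr (1 + 2 * e) * (c * f s) else 0)"
    define P' where "P' = (\<lambda>s. if s < S then (1 + 2 * e) * W s powr ((1 + 2 * e) - 1) * W' s * (c * f s)
       + W s powr (1 + 2 * e) * (c * f' s) else 0)"
    have dU: "(U has_real_derivative U' s) (at s)" if "0 \<le> s" for s
      unfolding U_def U'_def
      by (rule truncated_powr_deriv[OF dW _ Wpos WS _ S(1) that]) (use S1 e in auto)
    have dP: "(P has_real_derivative P' s) (at s)" if "0 \<le> s" for s
      unfolding P_def P'_def
      by (rule truncated_powr_deriv[OF dW DERIV_cmult[OF df] Wpos WS _ S(1) that]) (use S1 e in auto)
    have cU': "continuous_on {0..} U'"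
    proof -
      have "continuous_on {0..} (\<lambda>s. if s < S then W s powr e * ((1 + e) * W' s) else 0)"
        by (intro truncated_powr_continuous cW Wpos WS e continuous_intros cW')
      then show ?thesis by (rule continuous_on_eq) (simp add: U'_def)
    qed
    have cP': "continuous_on {0..} P'"
    proof -
      have "continuous_on {0..} (\<lambda>s. (if s < S then W s powr (2 * e) * ((1 + 2 * e) * (W' s * (c * f s))) else 0)
         + (if s < S then W s powr (1 + 2 * e) * (c * f' s) else 0))"
        using e by (intro continuous_on_add truncated_powr_continuous cW Wpos WS continuous_intros cW' cf cf') auto
      then show ?thesis by (rule continuous_on_eq) (simp add: P'_def mult_ac)
    qed
    define u where "u = (\<lambda>x :: real ^ 'n. U ((norm x)\<^sup>2))"
    define G where "G = (\<lambda>x :: real ^ 'n. (2 * U' ((norm x)\<^sup>2)) *\<^sub>R x)"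
    have "admissible r u G \<and> hyp_energy r G \<le> (c * mu) * hyp_mass r u"
    proof -
      have z: "U s = 0 \<and> U' s = 0 \<and> P s = 0 \<and> P' s = 0" if "S \<le> s" for s
        using that by (simp add: U_def U'_def P_def P'_def)
      have ineq: "conf_factor s ^ (CARD('n) - 2) * (4 * s * (U' s)\<^sup>2) - (c * mu) * conf_factor s ^ CARD('n) * (U s)\<^sup>2
        \<le> real CARD('n) * P s + 2 * s * P' s" if s: "0 \<le> s" "s < S" for s
      proof -
        define w where "w = W s"
        define A where "A = w powr e"
        define cc where "cc = conf_factor s ^ (2 * m)"
        have w: "w > 0" unfolding w_def by (rule Wpos[OF s])
        have pw: "w powr (1 + e) = w * A" "w powr (2 * e) = A\<^sup>2" "w powr (1 + 2 * e) = w * A\<^sup>2"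
        proof -
          show "w powr (1 + e) = w * A" unfolding A_def using w by (simp add: powr_add)
          show sq: "w powr (2 * e) = A\<^sup>2" unfolding A_def power2_eq_square by (simp flip: powr_add)
          show "w powr (1 + 2 * e) = w * A\<^sup>2" unfolding sq[symmetric] using w by (simp add: powr_add)
        qed
        have vals: "U s = w * A" "U' s = (1 + e) * A * W' s" "P s = w * A\<^sup>2 * (c * f s)"
          "P' s = (1 + 2 * e) * A\<^sup>2 * W' s * (c * f s) + w * A\<^sup>2 * (c * f' s)"
          using s unfolding U_def U'_def P_def P'_def w_def[symmetric] by (simp_all add: pw A_def[symmetric])
        have fc: "f s = 2 * cc * W' s" unfolding cc_def by (rule conf[OF s])
        have e1: "2 * s * ((1 + 2 * e) * A\<^sup>2 * W' s * (c * f s)) = cc * (4 * s * ((1 + e) * A * W' s)\<^sup>2)"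
        proof -
          have "2 * s * ((1 + 2 * e) * A\<^sup>2 * W' s * (c * f s)) = cc * (4 * s * ((c * (1 + 2 * e)) * (A\<^sup>2 * (W' s)\<^sup>2)))"
            unfolding fc by (simp add: power2_eq_square mult_ac)
          then show ?thesis unfolding ce by (simp add: power_mult_distrib)
        qed
        have "0 \<le> c * w * A\<^sup>2 * ((2 * real m + 2) * f s + 2 * s * f' s + mu * conf_factor s ^ (2 * m + 2) * w)"
          using key[OF s] c w unfolding w_def[symmetric] by (intro mult_nonneg_nonneg) auto
        also have "\<dots> = (2 * real m + 2) * P s + 2 * s * (w * A\<^sup>2 * (c * f' s)) + (c * mu) * conf_factor s ^ (2 * m + 2) * (U s)\<^sup>2"
          unfolding vals by (simp add: algebra_simps power2_eq_square)
        finally have "cc * (4 * s * (U' s)\<^sup>2) - (c * mu) * conf_factor s ^ (2 * m + 2) * (U s)\<^sup>2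
           \<le> (2 * real m + 2) * P s + 2 * s * P' s"
          unfolding vals(2,4) distrib_left e1 by linarith
        moreover have "2 * m + 2 - 2 = 2 * m" "real (2 * m + 2) = 2 * real m + 2" by simp_all
        ultimately show ?thesis unfolding cc_def dim by (simp only:)
      qed
      show ?thesis
        unfolding u_def G_def
        using radial_test_function[OF r S dU cU' dP cP' z ineq] by blast
    qed
    moreover have "u 0 \<noteq> 0"
      using Wpos[of 0] S by (simp add: u_def U_def)
    ultimately show ?thesis unfolding c_def by blast
  qed
  then show "\<exists>(u :: real ^ 'n \<Rightarrow> real) G x. admissible r u G \<and> u x \<noteq> 0" using zero_less_one by blast
  have "lambda1_hyp TYPE('n) r \<le> (1 + e)\<^sup>2 / (1 + 2 * e) * mu" if "0 < e" for e
    using test[OF that] lambda1_hyp_le[OF r] by blast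
  then have "\<forall>\<^sub>F e in at_right 0. lambda1_hyp TYPE('n) r \<le> (1 + e)\<^sup>2 / (1 + 2 * e) * mu"
    by (intro eventually_mono[OF eventually_at_right_less])
  moreover have "((\<lambda>e::real. (1 + e)\<^sup>2 / (1 + 2 * e) * mu) \<longlongrightarrow> (1 + 0)\<^sup>2 / (1 + 2 * 0) * mu) (at_right 0)"
    by (intro tendsto_intros) auto
  ultimately have "lambda1_hyp TYPE('n) r \<le> (1 + 0)\<^sup>2 / (1 + 2 * 0) * mu"
    by (intro tendsto_lowerbound[of _ _ "at_right 0"]) auto
  then show "lambda1_hyp TYPE('n) r \<le> (real m + 1/2)\<^sup>2 + lam\<^sup>2" by (simp add: mu_def p_def)
qed

section \<open>The eigenvalue asymptotics\<close>

lemma first_zero: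
  fixes X :: "real \<Rightarrow> real"
  assumes cont: "continuous_on {0..T} X" and T: "0 < T" and X: "0 < X 0" "X T < 0"
  obtains S where "0 < S" "S < T" "X S = 0" "\<And>s. 0 \<le> s \<Longrightarrow> s < S \<Longrightarrow> 0 < X s"
proof -
  let ?Z = "{s \<in> {0..T}. X s = 0}"
  have "\<exists>s\<ge>0. s \<le> T \<and> X s = 0"
    by (rule IVT2') (use assms in auto)
  then have ne: "?Z \<noteq> {}" by auto
  have "compact ?Z"
    using continuous_closed_preimage_constant[OF cont, of 0]
    by (intro compact_eq_bounded_closed[THEN iffD2] conjI) (auto intro: bounded_subset[OF bounded_closed_interval])
  then obtain S where S: "S \<in> ?Z" "\<And>s. s \<in> ?Z \<Longrightarrow> S \<le> s"
    using compact_attains_inf[OF _ ne] by blast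
  have S0: "0 < S" "S < T" using S(1) X by (auto simp: order.order_iff_strict)
  moreover have "0 < X s" if s: "0 \<le> s" "s < S" for s
  proof (rule ccontr)
    assume "\<not> 0 < X s"
    then have "\<exists>z\<ge>0. z \<le> s \<and> X z = 0"
      by (intro IVT2') (use s X S0 in \<open>auto intro: continuous_on_subset[OF cont]\<close>)
    then obtain z where "0 \<le> z" "z \<le> s" "X z = 0" by blast
    then show False using S(2)[of z] s S0 by auto
  qed
  ultimately show ?thesis using that S(1) by blast
qed

lemma half_le_sin:
  fixes y :: real
  assumes "0 \<le> y" "y \<le> 1"
  shows "y / 2 \<le> sin y"
proof -
  have "sin 0 - 0 / 2 \<le> sin y - y / 2"
  proof (rule DERIV_nonneg_imp_nondecreasing[OF assms(1)])
    fix t assume t: "0 \<le> t" "t \<le> y"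
    have "cos (pi / 3) \<le> cos t" using t assms pi_gt3 by (intro cos_monotone_0_pi_le) auto
    then have "0 \<le> cos t - 1 / 2" by (simp add: cos_60)
    moreover have "((\<lambda>y. sin y - y / 2) has_real_derivative cos t - 1 / 2) (at t)"
      by (auto intro!: derivative_eq_intros)
    ultimately show "\<exists>d. ((\<lambda>y. sin y - y / 2) has_real_derivative d) (at t) \<and> 0 \<le> d" by blast
  qed
  then show ?thesis by simp
qed

lemma sin_ge_sin_near_ends:
  fixes x y :: real
  assumes "0 \<le> y" "y \<le> x" "x \<le> pi - y"
  shows "sin y \<le> sin x"
proof (cases "x \<le> pi / 2")
  case True
  then show ?thesis using assms pi_gt_zero by (intro sin_monotone_2pi_le) linarith+
next
  case False
  then have "sin y \<le> sin (pi - x)" using assms pi_gt_zero by (intro sin_monotone_2pi_le) linarith+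
  then show ?thesis by simp
qed

text \<open>Why 2 eps: with lam = pi/(h + 2 eps) and shift eps the phase stays between lam eps and
  pi - lam eps, so the sine is at least lam eps / 2 and exceeds the correction, which is at most k
  lam <= lam eps / 4. With lam = pi/(h - 2 eps) and shift -eps the phase ends at pi + lam eps, where
  the sine is negative enough to outweigh the correction and forces a zero inside the ball.\<close>

lemma lambda1_hyp_bounds:
  fixes m :: nat
  assumes dim: "CARD('n::finite) = 2 * m + 2"
    and eps: "0 < eps" "eps \<le> 1" "eps \<le> zero_sol m 0"
  obtains lam1 where "0 < lam1"
    "\<And>r h. \<lbrakk>0 < r; h = 2 * zero_sol m (euclid_radius_sq r); 0 < h - 2 * eps; pi / (h - 2 * eps) \<le> lam1\<rbrakk>
      \<Longrightarrow> (real m + 1/2)\<^sup>2 + (pi / (h + 2 * eps))\<^sup>2 \<le> lambda1_hyp TYPE('n) r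
        \<and> lambda1_hyp TYPE('n) r \<le> (real m + 1/2)\<^sup>2 + (pi / (h - 2 * eps))\<^sup>2"
proof -
  obtain k lam0 where k: "0 < k" "k \<le> eps / 4" and lam0: "0 < lam0"
    and sgn: "\<And>lam s sg. \<lbrakk>0 < lam; lam \<le> lam0; 0 \<le> s; s < 1; sg = 1 \<or> sg = -1\<rbrakk>
       \<Longrightarrow> sg * trial_residual m (sg * eps) (sg * k) lam s \<le> 0"
    using trial_residual_sign[OF eps] by blast
  define J0 where "J0 = zero_sol m 0"
  have J0: "0 < J0" "eps \<le> J0" unfolding J0_def using zero_sol_pos_at_0 eps by auto
  \<comment> \<open>The bound 1 gives lam eps <= 1, as \<open>half_le_sin\<close> requires; 1/(2 J0)
    keeps the phase at the centre within (0, 1], so that the subsolution starts out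
    positive.\<close>
  define lam1 where "lam1 = min lam0 (min 1 (1 / (2 * J0)))"
  have lam1: "0 < lam1" unfolding lam1_def using lam0 J0 by simp
  have "(real m + 1/2)\<^sup>2 + (pi / (h + 2 * eps))\<^sup>2 \<le> lambda1_hyp TYPE('n) r
        \<and> lambda1_hyp TYPE('n) r \<le> (real m + 1/2)\<^sup>2 + (pi / (h - 2 * eps))\<^sup>2"
    if r: "0 < r" and h: "h = 2 * zero_sol m (euclid_radius_sq r)" and hpos: "0 < h - 2 * eps"
      and small: "pi / (h - 2 * eps) \<le> lam1" for r h
  proof -
    let ?T = "euclid_radius_sq r"
    note T = euclid_radius_sq_bounds[OF r]
    have lam: "0 < pi / (h - 2 * eps)" "pi / (h - 2 * eps) \<le> lam0" "pi / (h - 2 * eps) \<le> 1"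
      "pi / (h - 2 * eps) * (2 * J0) \<le> 1"
    proof -
      show "0 < pi / (h - 2 * eps)" using hpos pi_gt_zero by simp
      show "pi / (h - 2 * eps) \<le> lam0" "pi / (h - 2 * eps) \<le> 1" using small by (auto simp: lam1_def)
      have "pi / (h - 2 * eps) \<le> 1 / (2 * J0)" using small by (auto simp: lam1_def)
      then show "pi / (h - 2 * eps) * (2 * J0) \<le> 1" using J0 by (simp add: le_divide_eq)
    qed
    have powr1: "(1 - s) powr (1/4) \<le> 1" "0 \<le> (1 - s) powr (1/4)" if "0 \<le> s" "s < 1" for s :: real
      using that by (auto intro: powr_le1)
    have upper: "(\<exists>(u :: real ^ 'n \<Rightarrow> real) G x. admissible r u G \<and> u x \<noteq> 0)
        \<and> lambda1_hyp TYPE('n) r \<le> (real m + 1/2)\<^sup>2 + (pi / (h - 2 * eps))\<^sup>2"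
    proof -
      define la where "la = pi / (h - 2 * eps)"
      note la = lam[folded la_def]
      let ?X = "trial m (- eps) (- k) la"
      have cont: "continuous_on {0..?T} ?X"
        by (rule DERIV_continuous_on[OF has_field_derivative_at_within[OF trial_deriv]]) (use T in simp)
      have X0: "0 < ?X 0"
      proof -
        have "0 < la * (2 * J0 - eps)" using la J0 eps by (intro mult_pos_pos) auto
        moreover have "la * (2 * J0 - eps) \<le> 1"
          unfolding right_diff_distrib using la(4) mult_pos_pos[OF la(1) eps(1)] by linarith
        ultimately have "0 < sin (la * (2 * J0 - eps))"
          using pi_gt3 by (intro sin_gt_zero) linarith+
        moreover have "0 < k * la" using k la by simp
        ultimately show ?thesis by (simp add: trial_def J0_def)
      qed
      have XT: "?X ?T < 0"
      proof -
        have "la * (h - eps) = pi + la * eps" unfolding la_def using hpos by (simp add: field_simps)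
        then have s: "sin (la * (h - eps)) = - sin (la * eps)" by simp
        have "la * eps \<le> 1" using la eps by (simp add: mult_le_one)
        then have "la * eps / 2 \<le> sin (la * eps)" using la eps by (intro half_le_sin) auto
        moreover have "k * la * (1 - ?T) powr (1/4) \<le> k * la * 1"
          using powr1[of ?T] T k la by (intro mult_left_mono) auto
        moreover have "k * la \<le> eps / 4 * la" using k la by (intro mult_right_mono) auto
        moreover have "0 < la * eps" using la eps by simp
        ultimately show ?thesis using s by (simp add: trial_def h[symmetric] mult.commute)
      qed
      obtain S where S: "0 < S" "S < ?T" "?X S = 0" "\<And>s. 0 \<le> s \<Longrightarrow> s < S \<Longrightarrow> 0 < ?X s"
        using first_zero[OF cont T(1) X0 XT] by blast
      have res: "0 \<le> s * trial_flux' m (- eps) (- k) la s + (real m + 1) * trial_flux m (- eps) (- k) la s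
          - (real m + 1/2) / 2 * ?X s + la\<^sup>2 / (1 - s) * ?X s" if "0 \<le> s" "s < S" for s
        using sgn[OF la(1,2), of s "-1"] that S T unfolding trial_residual_def by simp
      show ?thesis unfolding la_def[symmetric]
        using lambda1_hyp_le_of_subsolution[OF r dim S(1,2) trial_deriv trial_flux_deriv
          trial_flux'_continuous S(4,3) res] by blast
    qed
    have lower: "((real m + 1/2)\<^sup>2 + (pi / (h + 2 * eps))\<^sup>2) * hyp_mass r u \<le> hyp_energy r G"
      if adm: "admissible r u G" for u :: "real ^ 'n \<Rightarrow> real" and G
    proof -
      define la where "la = pi / (h + 2 * eps)"
      have le: "la \<le> pi / (h - 2 * eps)"
        unfolding la_def using hpos eps pi_gt_zero by (intro divide_left_mono mult_pos_pos) auto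
      have la: "0 < la" "la \<le> lam0" "la \<le> 1"
      proof -
        show "0 < la" unfolding la_def using hpos eps pi_gt_zero by (intro divide_pos_pos) linarith+
        show "la \<le> lam0" "la \<le> 1" using le lam by linarith+
      qed
      let ?X = "trial m eps k la"
      have pos: "0 < ?X s" if s: "0 \<le> s" "s < ?T" for s
      proof -
        have s1: "s < 1" using s T by simp
        have mono: "J0 \<le> zero_sol m s" "zero_sol m s \<le> zero_sol m ?T"
          unfolding J0_def using zero_sol_mono s T by auto
        define x where "x = la * (2 * zero_sol m s + eps)"
        have "la * eps \<le> x" unfolding x_def using la mono J0 by (intro mult_left_mono) auto
        moreover have "x \<le> la * (h + eps)"
          unfolding x_def h using la mono by (intro mult_left_mono) auto
        moreover have "la * (h + eps) = pi - la * eps" unfolding la_def using hpos eps by (simp add: field_simps)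
        ultimately have "sin (la * eps) \<le> sin x" using la eps by (intro sin_ge_sin_near_ends) auto
        moreover have "la * eps / 2 \<le> sin (la * eps)"
          using la eps by (intro half_le_sin) (auto simp: mult_le_one)
        moreover have "k * la * (1 - s) powr (1/4) \<le> k * la * 1"
          using powr1[of s] s s1 k la by (intro mult_left_mono) auto
        moreover have "k * la \<le> eps / 4 * la" using k la by (intro mult_right_mono) auto
        moreover have "0 < la * eps" using la eps by simp
        ultimately show ?thesis by (simp add: trial_def x_def[symmetric] mult.commute)
      qed
      have res: "s * trial_flux' m eps k la s + (real m + 1) * trial_flux m eps k la s
          - (real m + 1/2) / 2 * ?X s + la\<^sup>2 / (1 - s) * ?X s \<le> 0" if "0 \<le> s" "s < ?T" for s
        using sgn[OF la(1,2), of s 1] that T unfolding trial_residual_def by simp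
      show ?thesis unfolding la_def[symmetric]
        by (rule energy_ge_of_supersolution[OF r dim adm trial_deriv trial_flux_deriv
          trial_flux'_continuous pos res])
    qed
    show ?thesis using upper lambda1_hyp_ge[OF r _ _ lower] by blast
  qed
  then show ?thesis using that[OF lam1] by blast
qed

text \<open>1 - tanh^2 (r/2) = 2/(cosh r + 1) is asymptotic to 4 exp (-r), so -ln (1-s) at the
  boundary is r - 2 ln 2 + o(1); this cancels the ln 2 of \<open>zero_sol_limit\<close>.\<close>

lemma zero_sol_radius_limit:
  "((\<lambda>r. 2 * zero_sol m (euclid_radius_sq r) - r) \<longlongrightarrow> - 2 * c_const (Suc m)) at_top"
proof -
  have one: "1 - euclid_radius_sq r = 2 / (cosh r + 1)" for r
    unfolding euclid_radius_sq_def using cosh_real_ge_1[of r] by (simp add: field_simps)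
  have "filterlim euclid_radius_sq (at_left 1) at_top"
  proof (rule tendsto_imp_filterlim_at_left)
    show "(euclid_radius_sq \<longlongrightarrow> 1) at_top" unfolding euclid_radius_sq_def cosh_field_def by real_asymp
    show "\<forall>\<^sub>F r in at_top. euclid_radius_sq r < 1"
      using eventually_gt_at_top[of 0] by eventually_elim (rule euclid_radius_sq_bounds)
  qed
  from filterlim_compose[OF zero_sol_limit[of m] this]
  have 1: "((\<lambda>r. zero_sol m (euclid_radius_sq r) + ln (1 - euclid_radius_sq r) / 2) \<longlongrightarrow> ln 2 - c_const (Suc m)) at_top" .
  have 2: "((\<lambda>r. ln (1 - euclid_radius_sq r) + r) \<longlongrightarrow> 2 * ln 2) at_top"
  proof -
    have "((\<lambda>r::real. ln (2 / ((exp r + exp (- r)) / 2 + 1)) + r) \<longlongrightarrow> ln 4) at_top" by real_asymp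
    moreover have "ln 4 = 2 * ln (2::real)" using ln_realpow[of "2::real" 2] by simp
    ultimately show ?thesis unfolding one by (simp add: cosh_field_def)
  qed
  have "((\<lambda>r. 2 * (zero_sol m (euclid_radius_sq r) + ln (1 - euclid_radius_sq r) / 2) - (ln (1 - euclid_radius_sq r) + r))
     \<longlongrightarrow> 2 * (ln 2 - c_const (Suc m)) - 2 * ln 2) at_top"
    by (intro tendsto_diff tendsto_mult tendsto_const 1 2)
  then show ?thesis by (simp add: algebra_simps)
qed

text \<open>For d = 0 the two expressions differ by O(r^-4), since (1 - 2c/r)^(-2) and (1 + 2c/r)^2
  share the linear term 4c/r. A displacement d of the denominator contributes 2 d pi^2 / r^3 to
  leading order.\<close>

lemma inverse_square_expansion:
  fixes c d :: real
  shows "((\<lambda>r. r ^ 3 * (pi\<^sup>2 / (r - 2 * c - d)\<^sup>2 - pi\<^sup>2 / r\<^sup>2 * (1 + 2 / r * c)\<^sup>2)) \<longlongrightarrow> 2 * d * pi\<^sup>2) at_top"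
  by (real_asymp simp: algebra_simps)

theorem theorem1p1:
  fixes l :: nat
  assumes "l \<ge> 1" and "CARD('n) = 2 * l"
  shows "(\<lambda>r. lambda1_hyp TYPE('n::finite) r
            - ((real CARD('n) - 1)\<^sup>2 / 4
               + pi\<^sup>2 / r\<^sup>2 * (1 + 2 / r * c_const l)\<^sup>2))
         \<in> o(\<lambda>r. 1 / r ^ 3)"
proof (rule landau_o.smallI)
  fix e :: real assume e: "e > 0"
  define m where "m = l - 1"
  have l: "l = Suc m" unfolding m_def using assms(1) by simp
  have dim: "CARD('n) = 2 * m + 2" using assms(2) l by simp
  define c where "c = c_const l"
  define tgt where "tgt = (\<lambda>r::real. pi\<^sup>2 / r\<^sup>2 * (1 + 2 / r * c)\<^sup>2)"
  \<comment> \<open>The total displacement of the denominator is 3 eps: 2 eps from the bracket of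
    the eigenvalue and one eps from replacing 2J by its limit r - 2c. The factor 12 makes 2 (3 eps)
    pi^2 at most e/2, leaving strict room below e.\<close>
  define eps where "eps = min (min 1 (zero_sol m 0)) (e / (12 * pi\<^sup>2))"
  have pi2: "pi\<^sup>2 > 0" by simp
  have eps: "0 < eps" "eps \<le> 1" "eps \<le> zero_sol m 0"
    unfolding eps_def using e zero_sol_pos_at_0[of m] by auto
  have small: "2 * (3 * eps) * pi\<^sup>2 < e"
  proof -
    have "eps \<le> e / (12 * pi\<^sup>2)" unfolding eps_def by simp
    then have "eps * (12 * pi\<^sup>2) \<le> e" using pi2 by (simp add: le_divide_eq)
    moreover have "0 < eps * pi\<^sup>2" using eps pi2 by simp
    ultimately show ?thesis by linarith
  qed
  obtain lam1 where lam1: "0 < lam1"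
    and bounds: "\<And>r h. \<lbrakk>0 < r; h = 2 * zero_sol m (euclid_radius_sq r); 0 < h - 2 * eps; pi / (h - 2 * eps) \<le> lam1\<rbrakk>
      \<Longrightarrow> (real m + 1/2)\<^sup>2 + (pi / (h + 2 * eps))\<^sup>2 \<le> lambda1_hyp TYPE('n) r
        \<and> lambda1_hyp TYPE('n) r \<le> (real m + 1/2)\<^sup>2 + (pi / (h - 2 * eps))\<^sup>2"
    using lambda1_hyp_bounds[OF dim eps] by blast
  have "\<forall>\<^sub>F r in at_top. dist (2 * zero_sol m (euclid_radius_sq r) - r) (- 2 * c) < eps"
    using tendstoD[OF zero_sol_radius_limit[of m] eps(1)] unfolding c_def l .
  moreover have "\<forall>\<^sub>F r in at_top. pi / (r - 2 * c - 3 * eps) < lam1"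
  proof (rule order_tendstoD(2)[OF _ lam1])
    show "((\<lambda>r. pi / (r - 2 * c - 3 * eps)) \<longlongrightarrow> 0) at_top" by real_asymp
  qed
  moreover have "\<forall>\<^sub>F r in at_top. r ^ 3 * (pi\<^sup>2 / (r - 2 * c - 3 * eps)\<^sup>2 - tgt r) < e"
    unfolding tgt_def by (rule order_tendstoD(2)[OF inverse_square_expansion small])
  moreover have "\<forall>\<^sub>F r in at_top. - e < r ^ 3 * (pi\<^sup>2 / (r - 2 * c - - 3 * eps)\<^sup>2 - tgt r)"
    unfolding tgt_def
    by (rule order_tendstoD(1)[OF inverse_square_expansion[of c "- 3 * eps"]]) (use small in simp)
  moreover have "\<forall>\<^sub>F r in at_top. max 0 (2 * c + 3 * eps) < r" by (rule eventually_gt_at_top)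
  ultimately show "\<forall>\<^sub>F r in at_top. norm (lambda1_hyp TYPE('n) r
            - ((real CARD('n) - 1)\<^sup>2 / 4 + pi\<^sup>2 / r\<^sup>2 * (1 + 2 / r * c_const l)\<^sup>2)) \<le> e * norm (1 / r ^ 3)"
  proof eventually_elim
    case (elim r)
    define h where "h = 2 * zero_sol m (euclid_radius_sq r)"
    have r: "0 < r" "0 < r - 2 * c - 3 * eps" using elim(5) by auto
    have h: "r - 2 * c - 3 * eps \<le> h - 2 * eps" "h + 2 * eps \<le> r - 2 * c - - 3 * eps"
      using elim(1) unfolding h_def dist_real_def by linarith+
    have hpos: "0 < h - 2 * eps" using h r by linarith
    have "pi / (h - 2 * eps) \<le> pi / (r - 2 * c - 3 * eps)"
      using h r by (intro divide_left_mono mult_pos_pos) auto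
    then have "pi / (h - 2 * eps) \<le> lam1" using elim(2) by linarith
    note b = bounds[OF r(1) h_def hpos this]
    define L where "L = lambda1_hyp TYPE('n) r - (real m + 1/2)\<^sup>2"
    have "L \<le> pi\<^sup>2 / (h - 2 * eps)\<^sup>2" using b unfolding L_def by (simp add: power_divide)
    also have "\<dots> \<le> pi\<^sup>2 / (r - 2 * c - 3 * eps)\<^sup>2"
      using h r by (intro divide_left_mono mult_pos_pos power_mono) auto
    finally have "r ^ 3 * (L - tgt r) \<le> r ^ 3 * (pi\<^sup>2 / (r - 2 * c - 3 * eps)\<^sup>2 - tgt r)"
      using r by (intro mult_left_mono) auto
    then have u: "r ^ 3 * (L - tgt r) < e" using elim(3) by linarith
    have "pi\<^sup>2 / (r - 2 * c - - 3 * eps)\<^sup>2 \<le> pi\<^sup>2 / (h + 2 * eps)\<^sup>2"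
      using h hpos eps by (intro divide_left_mono mult_pos_pos power_mono) auto
    also have "\<dots> \<le> L" using b unfolding L_def by (simp add: power_divide)
    finally have "r ^ 3 * (pi\<^sup>2 / (r - 2 * c - - 3 * eps)\<^sup>2 - tgt r) \<le> r ^ 3 * (L - tgt r)"
      using r by (intro mult_left_mono) auto
    then have "- e < r ^ 3 * (L - tgt r)" using elim(4) by linarith
    with u have "\<bar>r ^ 3 * (L - tgt r)\<bar> \<le> e" by linarith
    then have "\<bar>L - tgt r\<bar> \<le> e / r ^ 3" using r by (simp add: abs_mult le_divide_eq mult.commute)
    moreover have "(real CARD('n) - 1)\<^sup>2 / 4 = (real m + 1/2)\<^sup>2"
      unfolding dim by (simp add: field_simps power2_eq_square)
    ultimately show ?case using r unfolding L_def tgt_def c_def by (simp add: algebra_simps)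
  qed
qed

end
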